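(* Let $K$ be a finite ordered simplicial complex, and for $i=1,2$ let $\mathrm{pr}_i\colon K\times K\to K$ be the projection to the $i$-th factor. Then: (a) $\mathrm{TC}(\|K\|)=\mathrm{SimpD}(\mathrm{pr}_1,\mathrm{pr}_2)$; (b) $\mathrm{SimpD}(\mathrm{pr}_1,\mathrm{pr}_2)=\mathrm{SC}(K)$.
   Context: Complexes are ordered: an ordered complex is an abstract simplicial complex with a partial order on its vertices restricting to a total order on each simplex. $\|K\|$ is the geometric realization. Products are taken in the category of ordered complexes: the vertices of $K\times L$ are pairs of vertices, and a finite set of pairs is a simplex iff it can be written $\{(v_0,w_0),\dots,(v_n,w_n)\}$ with $v_0\le\cdots\le v_n$, $w_0\le\cdots\le w_n$, $\{v_0,\dots,v_n\}$ a simplex of $K$ and $\{w_0,\dots,w_n\}$ a simplex of $L$. A simplicial map is a map of vertices sending simplices to simplices. Contiguity: simplicial maps $\varphi,\psi\colon K\to L$ are contiguous if for every simplex $\sigma$ of $K$, $\varphi(\sigma)\cup\psi(\sigma)$ is a simplex of $L$. For $c\in\mathbb{Z}_{\ge0}$, they are $c$-contiguous ($\varphi\sim_c\psi$) if there are simplicial maps $H_0,\dots,H_c\colon K\to L$ with $H_0=\varphi$, $H_c=\psi$ and each pair $(H_{i-1},H_i)$ contiguous, $1\le i\le c$. Subdivisions: $\mathrm{Sd}^b(K)$ is the $b$-th iterated barycentric subdivision ($\mathrm{Sd}^0(K)=K$). For each $b\ge 0$ a simplicial approximation $\iota\colon\mathrm{Sd}^{b+1}(K)\to\mathrm{Sd}^b(K)$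 of the identity of $\|K\|$ is fixed (i.e. a simplicial map sending each vertex of $\mathrm{Sd}^{b+1}(K)$, regarded as a simplex $\sigma$ of $\mathrm{Sd}^b(K)$, to a vertex of $\sigma$); composites of these are also denoted $\iota\colon \mathrm{Sd}^b(K)\to K$. Simplicial distance: for simplicial maps $\varphi,\psi\colon K\to L$ and $b,c\in\mathbb{Z}_{\ge0}$, $\mathrm{SimpD}^b_c(\varphi,\psi)$ is the least integer $k\ge0$ such that there are subcomplexes $J_0,\dots,J_k$ covering $\mathrm{Sd}^b(K)$ for which the composites $J_i\hookrightarrow\mathrm{Sd}^b(K)\xrightarrow{\iota}K\xrightarrow{\varphi}L$ and $J_i\hookrightarrow\mathrm{Sd}^b(K)\xrightarrow{\iota}K\xrightarrow{\psi}L$ are $c$-contiguous for each $i$; it is $\infty$ if no such $k$ exists. It is non-increasing in $c$; $\mathrm{SimpD}^b(\varphi,\psi)$ denotes its stable value as $c\to\infty$. The sequence $\mathrm{SimpD}^b(\varphi,\psi)$ is non-increasing in $b$; $\mathrm{SimpD}(\varphi,\psi)$ denotes its stable value as $b\to\infty$. Simplicial complexity: $\mathrm{SC}^b_c(K)$ is the least integer $k\ge0$ such that there are subcomplexes $J_0,\dots,J_k$ covering $\mathrm{Sd}^b(K\times K)$ for which the composites $J_i\hookrightarrow\mathrm{Sd}^b(K\times K)\xrightarrow{\iota}K\times K\xrightarrow{\mathrm{pr}_r}K$, $r=1,2$, are $c$-contiguous for each $i$ ($\infty$ if there is no such $k$). $\mathrm{SC}^b(K)$ is the stable value as $c\to\infty$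 of the non-increasing sequence $\mathrm{SC}^b_c(K)$, and $\mathrm{SC}(K)$ is the stable value as $b\to\infty$ of the non-increasing sequence $\mathrm{SC}^b(K)$. Topological complexity (reduced): $\mathrm{TC}(X)$ is the least integer $k\ge0$ such that $X\times X$ is covered by open sets $U_0,\dots,U_k$ on each of which the path fibration $\pi\colon PX\to X\times X$, $\pi(\gamma)=(\gamma(0),\gamma(1))$, admits a continuous section ($\infty$ if there is none), where $PX$ is the space of paths $[0,1]\to X$. *)

theory Defs
  imports "HOL-Analysis.Analysis" "HOL-Library.FSet" "HOL-Library.Extended_Nat"
begin

section \<open>Ordered simplicial complexes\<close>

text \<open>Simplices are nonempty finite sets of vertices; every vertex lies in a simplex.\<close>

record 'a ocomplex =
  simplices :: "'a set set"
  vorder :: "'a rel"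

definition vertices :: "'a ocomplex \<Rightarrow> 'a set" where
  "vertices K = \<Union> (simplices K)"

definition ordered_complex :: "'a ocomplex \<Rightarrow> bool" where
  "ordered_complex K \<longleftrightarrow>
     (\<forall>\<sigma>\<in>simplices K. finite \<sigma> \<and> \<sigma> \<noteq> {}) \<and>
     (\<forall>\<sigma>\<in>simplices K. \<forall>\<tau>. \<tau> \<subseteq> \<sigma> \<and> \<tau> \<noteq> {} \<longrightarrow> \<tau> \<in> simplices K) \<and>
     partial_order_on (vertices K) (vorder K) \<and>
     (\<forall>\<sigma>\<in>simplices K. total_on \<sigma> (vorder K))"

definition finite_complex :: "'a ocomplex \<Rightarrow> bool" where
  "finite_complex K \<longleftrightarrow> finite (simplices K)"

definition subcomplex :: "'a ocomplex \<Rightarrow> 'a ocomplex \<Rightarrow> bool" where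
  "subcomplex J K \<longleftrightarrow>
     ordered_complex J \<and> simplices J \<subseteq> simplices K \<and>
     vorder J = Restr (vorder K) (vertices J)"

definition covers :: "('i \<Rightarrow> 'a ocomplex) \<Rightarrow> 'i set \<Rightarrow> 'a ocomplex \<Rightarrow> bool" where
  "covers J I K \<longleftrightarrow> (\<Union>i\<in>I. simplices (J i)) = simplices K"

definition prod_complex :: "'a ocomplex \<Rightarrow> 'b ocomplex \<Rightarrow> ('a \<times> 'b) ocomplex"
    (infixr \<open>\<times>\<^sub>o\<close> 80) where
  "K \<times>\<^sub>o L =
     \<lparr>simplices = {\<sigma>. \<exists>(n::nat) v w.
        \<sigma> = (\<lambda>i. (v i, w i)) ` {..n} \<and>
        (\<forall>i<n. (v i, v (Suc i)) \<in> vorder K \<and> (w i, w (Suc i)) \<in> vorder L) \<and>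
        v ` {..n} \<in> simplices K \<and> w ` {..n} \<in> simplices L},
      vorder = {((v, w), (v', w')). (v, v') \<in> vorder K \<and> (w, w') \<in> vorder L}\<rparr>"


section \<open>Simplicial maps and contiguity\<close>

text \<open>Maps of vertices are total HOL functions; only their values on \<^term>\<open>vertices K\<close>
  are meaningful, so equality of maps is equality on \<^term>\<open>vertices K\<close>. In particular
  restriction to a subcomplex leaves the function unchanged.\<close>

definition simplicial_map :: "'a ocomplex \<Rightarrow> 'b ocomplex \<Rightarrow> ('a \<Rightarrow> 'b) \<Rightarrow> bool" where
  "simplicial_map K L f \<longleftrightarrow> (\<forall>\<sigma>\<in>simplices K. f ` \<sigma> \<in> simplices L)"

definition contiguous :: "'a ocomplex \<Rightarrow> 'b ocomplex \<Rightarrow> ('a \<Rightarrow> 'b) \<Rightarrow> ('a \<Rightarrow> 'b) \<Rightarrow> bool" where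
  "contiguous K L f g \<longleftrightarrow> (\<forall>\<sigma>\<in>simplices K. f ` \<sigma> \<union> g ` \<sigma> \<in> simplices L)"

definition c_contiguous ::
    "nat \<Rightarrow> 'a ocomplex \<Rightarrow> 'b ocomplex \<Rightarrow> ('a \<Rightarrow> 'b) \<Rightarrow> ('a \<Rightarrow> 'b) \<Rightarrow> bool" where
  "c_contiguous c K L f g \<longleftrightarrow>
     (\<exists>H :: nat \<Rightarrow> 'a \<Rightarrow> 'b.
        (\<forall>i\<le>c. simplicial_map K L (H i)) \<and>
        (\<forall>v\<in>vertices K. H 0 v = f v) \<and>
        (\<forall>v\<in>vertices K. H c v = g v) \<and>
        (\<forall>i\<in>{1..c}. contiguous K L (H (i - 1)) (H i)))"


section \<open>Iterated barycentric subdivision\<close>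

text \<open>The vertices of a barycentric subdivision are the simplices of the given complex, so
  iterating leaves the type \<^typ>\<open>'a set\<close>. All iterates are therefore carried by one type of
  hereditarily finite sets over \<^typ>\<open>'a\<close>: \<open>Barycentre F\<close> is the simplex \<open>F\<close>
  regarded as a vertex of the subdivision, and \<open>Vertex v\<close> is the vertex \<open>v\<close> of the
  unsubdivided complex.\<close>

datatype 'a sd_vertex = Vertex (vertex_of: 'a) | Barycentre "'a sd_vertex fset"

definition vertex_copy :: "'a ocomplex \<Rightarrow> 'a sd_vertex ocomplex" where
  "vertex_copy K =
     \<lparr>simplices = (\<lambda>\<sigma>. Vertex ` \<sigma>) ` simplices K,
      vorder = (\<lambda>(v, w). (Vertex v, Vertex w)) ` vorder K\<rparr>"

definition sd :: "'a sd_vertex ocomplex \<Rightarrow> 'a sd_vertex ocomplex" where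
  "sd K =
     \<lparr>simplices = {Barycentre ` C |C.
        finite C \<and> C \<noteq> {} \<and> (\<forall>F\<in>C. fset F \<in> simplices K) \<and>
        (\<forall>F\<in>C. \<forall>G\<in>C. F |\<subseteq>| G \<or> G |\<subseteq>| F)},
      vorder = {(Barycentre F, Barycentre G) |F G.
        fset F \<in> simplices K \<and> fset G \<in> simplices K \<and> F |\<subseteq>| G}\<rparr>"

definition Sd :: "nat \<Rightarrow> 'a ocomplex \<Rightarrow> 'a sd_vertex ocomplex" where
  "Sd b K = (sd ^^ b) (vertex_copy K)"

text \<open>A choice, for every \<open>b\<close>, of a simplicial approximation
  \<open>Sd (b+1) K \<rightarrow> Sd b K\<close> of the identity.\<close>

definition sd_approximations ::
    "'a ocomplex \<Rightarrow> (nat \<Rightarrow> 'a sd_vertex \<Rightarrow> 'a sd_vertex) \<Rightarrow> bool" where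
  "sd_approximations K \<iota> \<longleftrightarrow>
     (\<forall>b. simplicial_map (Sd (Suc b) K) (Sd b K) (\<iota> b) \<and>
          (\<forall>F. Barycentre F \<in> vertices (Sd (Suc b) K) \<longrightarrow> \<iota> b (Barycentre F) |\<in>| F))"

text \<open>The composite \<open>Sd b K \<rightarrow> K\<close>; its last factor undoes the relabelling in
  \<^const>\<open>vertex_copy\<close>.\<close>

primrec sd_to_base :: "(nat \<Rightarrow> 'a sd_vertex \<Rightarrow> 'a sd_vertex) \<Rightarrow> nat \<Rightarrow> 'a sd_vertex \<Rightarrow> 'a" where
  "sd_to_base \<iota> 0 = vertex_of"
| "sd_to_base \<iota> (Suc b) = sd_to_base \<iota> b \<circ> \<iota> b"


section \<open>Simplicial distance and simplicial complexity\<close>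

definition least_or_infinity :: "(nat \<Rightarrow> bool) \<Rightarrow> enat" where
  "least_or_infinity P = (if \<exists>k. P k then enat (LEAST k. P k) else \<infinity>)"

definition stable_value :: "(nat \<Rightarrow> enat) \<Rightarrow> enat" where
  "stable_value f = (THE s. \<forall>\<^sub>F n in sequentially. f n = s)"

text \<open>The family \<open>\<iota>\<close> consists of the chosen approximations for the domain \<open>K\<close>.\<close>

definition SimpD_bc ::
    "'a ocomplex \<Rightarrow> 'b ocomplex \<Rightarrow> (nat \<Rightarrow> 'a sd_vertex \<Rightarrow> 'a sd_vertex)
      \<Rightarrow> nat \<Rightarrow> nat \<Rightarrow> ('a \<Rightarrow> 'b) \<Rightarrow> ('a \<Rightarrow> 'b) \<Rightarrow> enat" where
  "SimpD_bc K L \<iota> b c \<phi> \<psi> = least_or_infinity (\<lambda>k.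
     \<exists>J :: nat \<Rightarrow> 'a sd_vertex ocomplex.
       (\<forall>i\<le>k. subcomplex (J i) (Sd b K)) \<and>
       covers J {..k} (Sd b K) \<and>
       (\<forall>i\<le>k. c_contiguous c (J i) L (\<phi> \<circ> sd_to_base \<iota> b) (\<psi> \<circ> sd_to_base \<iota> b)))"

definition SimpD_b ::
    "'a ocomplex \<Rightarrow> 'b ocomplex \<Rightarrow> (nat \<Rightarrow> 'a sd_vertex \<Rightarrow> 'a sd_vertex)
      \<Rightarrow> nat \<Rightarrow> ('a \<Rightarrow> 'b) \<Rightarrow> ('a \<Rightarrow> 'b) \<Rightarrow> enat" where
  "SimpD_b K L \<iota> b \<phi> \<psi> = stable_value (\<lambda>c. SimpD_bc K L \<iota> b c \<phi> \<psi>)"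

definition SimpD ::
    "'a ocomplex \<Rightarrow> 'b ocomplex \<Rightarrow> (nat \<Rightarrow> 'a sd_vertex \<Rightarrow> 'a sd_vertex)
      \<Rightarrow> ('a \<Rightarrow> 'b) \<Rightarrow> ('a \<Rightarrow> 'b) \<Rightarrow> enat" where
  "SimpD K L \<iota> \<phi> \<psi> = stable_value (\<lambda>b. SimpD_b K L \<iota> b \<phi> \<psi>)"

text \<open>Here \<open>\<iota>\<close> consists of the chosen approximations for \<^term>\<open>K \<times>\<^sub>o K\<close>; the
  projections are \<^const>\<open>fst\<close> and \<^const>\<open>snd\<close>.\<close>

definition SC_bc ::
    "'a ocomplex \<Rightarrow> (nat \<Rightarrow> ('a \<times> 'a) sd_vertex \<Rightarrow> ('a \<times> 'a) sd_vertex)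
      \<Rightarrow> nat \<Rightarrow> nat \<Rightarrow> enat" where
  "SC_bc K \<iota> b c = least_or_infinity (\<lambda>k.
     \<exists>J :: nat \<Rightarrow> ('a \<times> 'a) sd_vertex ocomplex.
       (\<forall>i\<le>k. subcomplex (J i) (Sd b (K \<times>\<^sub>o K))) \<and>
       covers J {..k} (Sd b (K \<times>\<^sub>o K)) \<and>
       (\<forall>i\<le>k. c_contiguous c (J i) K (fst \<circ> sd_to_base \<iota> b) (snd \<circ> sd_to_base \<iota> b)))"

definition SC_b ::
    "'a ocomplex \<Rightarrow> (nat \<Rightarrow> ('a \<times> 'a) sd_vertex \<Rightarrow> ('a \<times> 'a) sd_vertex) \<Rightarrow> nat \<Rightarrow> enat" where
  "SC_b K \<iota> b = stable_value (\<lambda>c. SC_bc K \<iota> b c)"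

definition SC ::
    "'a ocomplex \<Rightarrow> (nat \<Rightarrow> ('a \<times> 'a) sd_vertex \<Rightarrow> ('a \<times> 'a) sd_vertex) \<Rightarrow> enat" where
  "SC K \<iota> = stable_value (\<lambda>b. SC_b K \<iota> b)"


section \<open>Geometric realization\<close>

text \<open>Points are given by barycentric coordinates; the topology is coherent with the closed
  simplices, each of which carries its Euclidean topology.\<close>

definition closed_simplex :: "'a set \<Rightarrow> ('a \<Rightarrow> real) set" where
  "closed_simplex \<sigma> = {x. (\<forall>v. 0 \<le> x v) \<and> (\<forall>v. v \<notin> \<sigma> \<longrightarrow> x v = 0) \<and> (\<Sum>v\<in>\<sigma>. x v) = 1}"

definition geometric_realization :: "'a ocomplex \<Rightarrow> ('a \<Rightarrow> real) topology" where
  "geometric_realization K = topology (\<lambda>U.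
     U \<subseteq> (\<Union>\<sigma>\<in>simplices K. closed_simplex \<sigma>) \<and>
     (\<forall>\<sigma>\<in>simplices K.
        openin (subtopology (powertop_real UNIV) (closed_simplex \<sigma>)) (U \<inter> closed_simplex \<sigma>)))"


section \<open>Topological complexity\<close>

text \<open>Paths are functions on the unit interval (extensional outside it); the path space has the
  compact-open topology.\<close>

definition paths :: "'a topology \<Rightarrow> (real \<Rightarrow> 'a) set" where
  "paths X = {\<gamma>. pathin X \<gamma> \<and> \<gamma> \<in> extensional {0..1}}"

definition path_space :: "'a topology \<Rightarrow> (real \<Rightarrow> 'a) topology" where
  "path_space X = topology_generated_by
     {{\<gamma> \<in> paths X. \<gamma> ` C \<subseteq> U} |C U. compact C \<and> C \<subseteq> {0..1} \<and> openin X U}"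

definition path_fibration :: "(real \<Rightarrow> 'a) \<Rightarrow> 'a \<times> 'a" where
  "path_fibration \<gamma> = (\<gamma> 0, \<gamma> 1)"

definition has_motion_planner :: "'a topology \<Rightarrow> ('a \<times> 'a) set \<Rightarrow> bool" where
  "has_motion_planner X U \<longleftrightarrow>
     (\<exists>s. continuous_map (subtopology (prod_topology X X) U) (path_space X) s \<and>
          (\<forall>p\<in>U. path_fibration (s p) = p))"

definition TC :: "'a topology \<Rightarrow> enat" where
  "TC X = least_or_infinity (\<lambda>k.
     \<exists>U :: nat \<Rightarrow> ('a \<times> 'a) set.
       (\<forall>i\<le>k. openin (prod_topology X X) (U i)) \<and>
       (\<Union>i\<le>k. U i) = topspace (prod_topology X X) \<and>
       (\<forall>i\<le>k. has_motion_planner X (U i)))"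


section \<open>Well-definedness\<close>

lemma openin_geometric_realization:
  "openin (geometric_realization K) U \<longleftrightarrow>
     U \<subseteq> (\<Union>\<sigma>\<in>simplices K. closed_simplex \<sigma>) \<and>
     (\<forall>\<sigma>\<in>simplices K.
        openin (subtopology (powertop_real UNIV) (closed_simplex \<sigma>)) (U \<inter> closed_simplex \<sigma>))"
proof -
  let ?o = "\<lambda>U. U \<subseteq> (\<Union>\<sigma>\<in>simplices K. closed_simplex \<sigma>) \<and>
     (\<forall>\<sigma>\<in>simplices K.
        openin (subtopology (powertop_real UNIV) (closed_simplex \<sigma>)) (U \<inter> closed_simplex \<sigma>))"
  have "istopology ?o"
    unfolding istopology_def
  proof (intro conjI allI impI ballI)
    fix S T \<sigma> assume "?o S" "?o T" "\<sigma> \<in> simplices K"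
    moreover have "S \<inter> T \<inter> closed_simplex \<sigma> = (S \<inter> closed_simplex \<sigma>) \<inter> (T \<inter> closed_simplex \<sigma>)"
      by blast
    ultimately show "openin (subtopology (powertop_real UNIV) (closed_simplex \<sigma>)) (S \<inter> T \<inter> closed_simplex \<sigma>)"
      by (metis openin_Int)
  next
    fix \<K> :: "('a \<Rightarrow> real) set set" and \<sigma> assume "\<forall>U\<in>\<K>. ?o U" "\<sigma> \<in> simplices K"
    moreover have "\<Union>\<K> \<inter> closed_simplex \<sigma> = (\<Union>U\<in>\<K>. U \<inter> closed_simplex \<sigma>)"
      by blast
    moreover have "openin (subtopology (powertop_real UNIV) (closed_simplex \<sigma>)) (\<Union>U\<in>\<K>. U \<inter> closed_simplex \<sigma>)"
      using calculation(1,2) by (intro openin_Union) blast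
    ultimately show "openin (subtopology (powertop_real UNIV) (closed_simplex \<sigma>)) (\<Union>\<K> \<inter> closed_simplex \<sigma>)"
      by simp
  qed blast+
  then show ?thesis
    unfolding geometric_realization_def by (simp add: topology_inverse')
qed

lemma topspace_geometric_realization:
  "topspace (geometric_realization K) = (\<Union>\<sigma>\<in>simplices K. closed_simplex \<sigma>)"
proof (rule antisym)
  have "openin (geometric_realization K) (\<Union>\<sigma>\<in>simplices K. closed_simplex \<sigma>)"
    unfolding openin_geometric_realization
  proof (intro conjI ballI)
    fix \<sigma> assume "\<sigma> \<in> simplices K"
    then have "(\<Union>\<sigma>\<in>simplices K. closed_simplex \<sigma>) \<inter> closed_simplex \<sigma> = closed_simplex \<sigma>"
      by blast
    then show "openin (subtopology (powertop_real UNIV) (closed_simplex \<sigma>))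
        ((\<Union>\<sigma>\<in>simplices K. closed_simplex \<sigma>) \<inter> closed_simplex \<sigma>)"
      by (simp add: openin_subtopology_refl)
  qed simp
  then show "(\<Union>\<sigma>\<in>simplices K. closed_simplex \<sigma>) \<subseteq> topspace (geometric_realization K)"
    by (rule openin_subset)
  show "topspace (geometric_realization K) \<subseteq> (\<Union>\<sigma>\<in>simplices K. closed_simplex \<sigma>)"
    using openin_geometric_realization openin_topspace by blast
qed

lemma topspace_path_space: "topspace (path_space X) = paths X"
proof -
  have "\<exists>C U. {\<gamma> \<in> paths X. \<gamma> ` C \<subseteq> U} = paths X \<and> compact C \<and> C \<subseteq> {0..1::real} \<and> openin X U"
    by (rule exI[of _ "{}"]) auto
  then show ?thesis
    unfolding path_space_def topology_generated_by_topspace by blast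
qed

lemma stable_value_eq:
  assumes "\<forall>\<^sub>F n in sequentially. f n = s"
  shows "stable_value f = s"
  unfolding stable_value_def
proof (rule the_equality)
  show "\<forall>\<^sub>F n in sequentially. f n = s" by (rule assms)
next
  fix t assume "\<forall>\<^sub>F n in sequentially. f n = t"
  with assms have "\<forall>\<^sub>F n in sequentially. s = t"
    by eventually_elim simp
  then show "t = s" by simp
qed

lemma stable_value_decseq:
  assumes "decseq f"
  shows "\<forall>\<^sub>F n in sequentially. f n = stable_value f"
proof -
  define m where "m = (LEAST x. x \<in> range f)"
  have "m \<in> range f"
    unfolding m_def by (rule LeastI) (rule rangeI[of f 0])
  then obtain N where N: "f N = m" by auto
  have "f n = m" if "n \<ge> N" for n
  proof (rule antisym)
    show "f n \<le> m" using decseqD[OF assms that] N by simp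
    show "m \<le> f n" unfolding m_def by (rule Least_le) simp
  qed
  then have ev: "\<forall>\<^sub>F n in sequentially. f n = m"
    unfolding eventually_sequentially by blast
  with stable_value_eq[OF ev] show ?thesis by simp
qed

lemma ordered_complex_face:
  assumes "ordered_complex K" "\<sigma> \<in> simplices K" "\<tau> \<subseteq> \<sigma>" "\<tau> \<noteq> {}"
  shows "\<tau> \<in> simplices K"
  using assms unfolding ordered_complex_def by blast

lemma ordered_complex_prod:
  assumes K: "ordered_complex K" and L: "ordered_complex L"
  shows "ordered_complex (K \<times>\<^sub>o L)"
proof -
  have mono: "(u i, u j) \<in> vorder M"
    if M: "ordered_complex M" and S: "u ` {..n} \<in> simplices M"
      and u: "\<forall>i<n. (u i, u (Suc i)) \<in> vorder M" and ij: "i \<le> j" "j \<le> n"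
    for M :: "'c ocomplex" and u :: "nat \<Rightarrow> 'c" and n i j
    using ij
  proof (induction j rule: dec_induct)
    case base
    then have "u i \<in> vertices M" using S unfolding vertices_def by (intro UnionI[OF S]) simp
    then show ?case
      using M unfolding ordered_complex_def partial_order_on_def preorder_on_def
      by (auto dest: refl_onD)
  next
    case (step m)
    then have "(u i, u m) \<in> vorder M" "(u m, u (Suc m)) \<in> vorder M" using u by auto
    then show ?case
      using M unfolding ordered_complex_def partial_order_on_def preorder_on_def
      by (meson transD)
  qed
  have vert: "vertices (K \<times>\<^sub>o L) = vertices K \<times> vertices L"
  proof (rule antisym; rule subsetI)
    fix x assume "x \<in> vertices (K \<times>\<^sub>o L)"
    then show "x \<in> vertices K \<times> vertices L"
      by (auto simp: vertices_def prod_complex_def)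
  next
    fix x assume "x \<in> vertices K \<times> vertices L"
    then obtain a b \<sigma> \<tau> where x: "x = (a, b)" "a \<in> \<sigma>" "\<sigma> \<in> simplices K" "b \<in> \<tau>" "\<tau> \<in> simplices L"
      by (auto simp: vertices_def)
    then have ab: "{a} \<in> simplices K" "{b} \<in> simplices L"
      using ordered_complex_face[OF K x(3), of "{a}"] ordered_complex_face[OF L x(5), of "{b}"] by simp_all
    have "{(a, b)} \<in> simplices (K \<times>\<^sub>o L)"
      using ab unfolding prod_complex_def
      by (auto intro!: exI[of _ 0] exI[of _ "\<lambda>_. a"] exI[of _ "\<lambda>_. b"])
    then show "x \<in> vertices (K \<times>\<^sub>o L)" using x by (auto simp: vertices_def)
  qed
  have sub: "\<tau> \<in> simplices (K \<times>\<^sub>o L)"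
    if face: "\<sigma> \<in> simplices (K \<times>\<^sub>o L)" "\<tau> \<subseteq> \<sigma>" "\<tau> \<noteq> {}" for \<sigma> \<tau>
  proof -
    obtain n :: nat and v w where s: "\<sigma> = (\<lambda>i. (v i, w i)) ` {..n}"
      "\<forall>i<n. (v i, v (Suc i)) \<in> vorder K \<and> (w i, w (Suc i)) \<in> vorder L"
      "v ` {..n} \<in> simplices K" "w ` {..n} \<in> simplices L"
      using face(1) unfolding prod_complex_def by auto
    define I where "I = {i. i \<le> n \<and> (v i, w i) \<in> \<tau>}"
    have I: "finite I" "I \<noteq> {}" "I \<subseteq> {..n}" and tau: "\<tau> = (\<lambda>i. (v i, w i)) ` I"
      using face(2,3) s(1) unfolding I_def by auto
    define m where "m = card I - 1"
    define e where "e = (!) (sorted_list_of_set I)"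
    have len: "length (sorted_list_of_set I) = Suc m"
      using I unfolding m_def by (simp add: card_gt_0_iff)
    have "e ` {..m} = set (sorted_list_of_set I)"
      unfolding e_def set_conv_nth len by (auto simp: less_Suc_eq_le)
    then have eI: "e ` {..m} = I" using I by simp
    have emono: "e i \<le> e (Suc i)" if "i < m" for i
      unfolding e_def using that len by (simp add: sorted_nth_mono)
    have en: "e i \<le> n" if "i \<le> m" for i using eI I that by auto
    have "(\<lambda>i. (v (e i), w (e i))) ` {..m} = (\<lambda>i. (v i, w i)) ` (e ` {..m})"
      by (simp add: image_image)
    then have "\<tau> = (\<lambda>i. (v (e i), w (e i))) ` {..m}"
      using tau eI by simp
    moreover have "(\<lambda>i. v (e i)) ` {..m} \<in> simplices K" "(\<lambda>i. w (e i)) ` {..m} \<in> simplices L"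
    proof -
      have "(\<lambda>i. v (e i)) ` {..m} \<subseteq> v ` {..n}" "(\<lambda>i. w (e i)) ` {..m} \<subseteq> w ` {..n}"
        using en by auto
      then show "(\<lambda>i. v (e i)) ` {..m} \<in> simplices K" "(\<lambda>i. w (e i)) ` {..m} \<in> simplices L"
        using ordered_complex_face[OF K s(3)] ordered_complex_face[OF L s(4)] by simp_all
    qed
    moreover have "\<forall>i<m. (v (e i), v (e (Suc i))) \<in> vorder K \<and> (w (e i), w (e (Suc i))) \<in> vorder L"
      using mono[OF K s(3)] mono[OF L s(4)] s(2) emono en by auto
    ultimately show ?thesis
      unfolding prod_complex_def
      by (simp, intro exI[of _ m] exI[of _ "\<lambda>i. v (e i)"] exI[of _ "\<lambda>i. w (e i)"]) simp
  qed
  have "partial_order_on (vertices K) (vorder K)" "partial_order_on (vertices L) (vorder L)"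
    using K L by (auto simp: ordered_complex_def)
  then have po: "partial_order_on (vertices (K \<times>\<^sub>o L)) (vorder (K \<times>\<^sub>o L))"
    unfolding vert unfolding partial_order_on_def preorder_on_def prod_complex_def
    by (fastforce simp: refl_on_def intro!: transI antisymI dest: transD antisymD)
  have tot: "total_on \<sigma> (vorder (K \<times>\<^sub>o L))" if sig: "\<sigma> \<in> simplices (K \<times>\<^sub>o L)" for \<sigma>
  proof -
    obtain n :: nat and v w where s: "\<sigma> = (\<lambda>i. (v i, w i)) ` {..n}"
      "\<forall>i<n. (v i, v (Suc i)) \<in> vorder K \<and> (w i, w (Suc i)) \<in> vorder L"
      "v ` {..n} \<in> simplices K" "w ` {..n} \<in> simplices L"
      using sig unfolding prod_complex_def by auto
    show ?thesis
    proof (rule total_onI)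
      fix x y assume "x \<in> \<sigma>" "y \<in> \<sigma>"
      then obtain i j where ij: "x = (v i, w i)" "y = (v j, w j)" "i \<le> n" "j \<le> n"
        using s(1) by auto
      have *: "((v i, w i), (v j, w j)) \<in> vorder (K \<times>\<^sub>o L)" if "i \<le> j" "j \<le> n" for i j
        using mono[OF K s(3)] mono[OF L s(4)] s(2) that unfolding prod_complex_def by auto
      show "(x, y) \<in> vorder (K \<times>\<^sub>o L) \<or> (y, x) \<in> vorder (K \<times>\<^sub>o L)"
        using * ij by (metis nat_le_linear)
    qed
  qed
  show ?thesis
    unfolding ordered_complex_def
    using sub po tot by (auto simp: prod_complex_def)
qed

lemma ordered_complex_vertex_copy:
  assumes "ordered_complex K"
  shows "ordered_complex (vertex_copy K)"
proof -
  have v: "vertices (vertex_copy K) = Vertex ` vertices K"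
    by (auto simp: vertices_def vertex_copy_def)
  have "partial_order_on (vertices K) (vorder K)"
    using assms by (simp add: ordered_complex_def)
  then have "partial_order_on (vertices (vertex_copy K)) (vorder (vertex_copy K))"
    unfolding v unfolding partial_order_on_def preorder_on_def vertex_copy_def
    by (fastforce simp: refl_on_def intro!: transI antisymI dest: transD antisymD)
  moreover have "\<tau> \<in> simplices (vertex_copy K)"
    if face: "\<sigma> \<in> simplices (vertex_copy K)" "\<tau> \<subseteq> \<sigma>" "\<tau> \<noteq> {}" for \<sigma> \<tau>
  proof -
    obtain \<rho> where "\<rho> \<in> simplices K" "\<sigma> = Vertex ` \<rho>"
      using face(1) by (auto simp: vertex_copy_def)
    moreover obtain \<rho>' where "\<rho>' \<subseteq> \<rho>" "\<tau> = Vertex ` \<rho>'"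
      using face(2) calculation by (auto simp: subset_image_iff)
    ultimately show ?thesis
      using ordered_complex_face[OF assms] face(3) by (auto simp: vertex_copy_def)
  qed
  moreover have "\<forall>\<sigma>\<in>simplices K. total_on \<sigma> (vorder K)"
    using assms by (simp add: ordered_complex_def)
  then have "\<forall>\<sigma>\<in>simplices (vertex_copy K). total_on \<sigma> (vorder (vertex_copy K))"
    by (fastforce simp: vertex_copy_def total_on_def)
  moreover have "\<forall>\<sigma>\<in>simplices (vertex_copy K). finite \<sigma> \<and> \<sigma> \<noteq> {}"
    using assms by (auto simp: ordered_complex_def vertex_copy_def)
  ultimately show ?thesis
    unfolding ordered_complex_def by simp
qed

lemma ordered_complex_sd: "ordered_complex (sd K)"
proof -
  have v: "vertices (sd K) = {Barycentre F |F. fset F \<in> simplices K}"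
  proof (rule antisym; rule subsetI)
    fix x assume "x \<in> {Barycentre F |F. fset F \<in> simplices K}"
    then obtain F where F: "x = Barycentre F" "fset F \<in> simplices K" by auto
    have "Barycentre ` {F} \<in> simplices (sd K)"
      unfolding sd_def using F by (simp, intro exI[of _ "{F}"]) simp
    then show "x \<in> vertices (sd K)" using F by (auto simp: vertices_def)
  qed (auto simp: vertices_def sd_def)
  have "partial_order_on (vertices (sd K)) (vorder (sd K))"
    unfolding v unfolding partial_order_on_def preorder_on_def sd_def
    by (auto simp: refl_on_def intro!: transI antisymI)
  moreover have "\<tau> \<in> simplices (sd K)"
    if face: "\<sigma> \<in> simplices (sd K)" "\<tau> \<subseteq> \<sigma>" "\<tau> \<noteq> {}" for \<sigma> \<tau>
  proof -
    obtain C where C: "\<sigma> = Barycentre ` C" "finite C" "\<forall>F\<in>C. fset F \<in> simplices K"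
      "\<forall>F\<in>C. \<forall>G\<in>C. F |\<subseteq>| G \<or> G |\<subseteq>| F"
      using face(1) by (auto simp: sd_def)
    obtain D where D: "D \<subseteq> C" "\<tau> = Barycentre ` D"
      using face(2) C(1) by (auto simp: subset_image_iff)
    have "finite D" "D \<noteq> {}" "\<forall>F\<in>D. fset F \<in> simplices K"
      "\<forall>F\<in>D. \<forall>G\<in>D. F |\<subseteq>| G \<or> G |\<subseteq>| F"
      using C(3,4) D face(3) finite_subset[OF D(1) C(2)] by (simp_all add: subset_iff)
    then have "Barycentre ` D \<in> simplices (sd K)"
      unfolding sd_def by (simp, intro exI[of _ D]) simp
    then show ?thesis using D by simp
  qed
  moreover have "total_on \<sigma> (vorder (sd K))" if sig: "\<sigma> \<in> simplices (sd K)" for \<sigma>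
  proof (rule total_onI)
    fix x y assume xy: "x \<in> \<sigma>" "y \<in> \<sigma>"
    obtain C where C: "\<sigma> = Barycentre ` C" "\<forall>F\<in>C. fset F \<in> simplices K"
      "\<forall>F\<in>C. \<forall>G\<in>C. F |\<subseteq>| G \<or> G |\<subseteq>| F"
      using sig by (auto simp: sd_def)
    obtain F G where FG: "x = Barycentre F" "y = Barycentre G" "F \<in> C" "G \<in> C"
      using xy C(1) by blast
    then have "F |\<subseteq>| G \<or> G |\<subseteq>| F" "fset F \<in> simplices K" "fset G \<in> simplices K"
      using C(2,3) by (metis, metis, metis)
    then show "(x, y) \<in> vorder (sd K) \<or> (y, x) \<in> vorder (sd K)"
      using FG(1,2) by (simp add: sd_def)
  qed
  moreover have "\<forall>\<sigma>\<in>simplices (sd K). finite \<sigma> \<and> \<sigma> \<noteq> {}"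
    by (auto simp: sd_def)
  ultimately show ?thesis
    unfolding ordered_complex_def by simp
qed

lemma ordered_complex_Sd:
  assumes "ordered_complex K"
  shows "ordered_complex (Sd b K)"
  by (cases b) (simp_all add: Sd_def ordered_complex_vertex_copy[OF assms] ordered_complex_sd)

lemma sd_approximations_exist:
  assumes "ordered_complex K"
  shows "\<exists>\<iota>. sd_approximations K \<iota>"
proof -
  define \<iota> :: "nat \<Rightarrow> 'a sd_vertex \<Rightarrow> 'a sd_vertex" where
    "\<iota> = (\<lambda>_ x. case x of Barycentre F \<Rightarrow> SOME y. y |\<in>| F | Vertex v \<Rightarrow> Vertex v)"
  have pick: "\<iota> b (Barycentre F) |\<in>| F" if "fset F \<in> simplices (Sd b K)" for b F
  proof -
    have "fset F \<noteq> {}" using that ordered_complex_Sd[OF assms, of b] by (auto simp: ordered_complex_def)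
    then have "\<exists>y. y |\<in>| F" by auto
    then show ?thesis unfolding \<iota>_def by (auto intro: someI_ex)
  qed
  have "simplicial_map (Sd (Suc b) K) (Sd b K) (\<iota> b)" for b
    unfolding simplicial_map_def
  proof
    fix \<sigma> assume "\<sigma> \<in> simplices (Sd (Suc b) K)"
    then obtain C where C: "\<sigma> = Barycentre ` C" "finite C" "C \<noteq> {}"
      "\<forall>F\<in>C. fset F \<in> simplices (Sd b K)" "\<forall>F\<in>C. \<forall>G\<in>C. F |\<subseteq>| G \<or> G |\<subseteq>| F"
      by (auto simp: Sd_def sd_def)
    obtain M where M: "M \<in> C" "\<forall>F\<in>C. F |\<subseteq>| M"
      using finite_has_maximal[OF C(2,3)] C(5) by (metis order_antisym)
    have "\<iota> b (Barycentre F) |\<in>| M" if F: "F \<in> C" for F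
    proof -
      have "\<iota> b (Barycentre F) |\<in>| F" using C(4) F by (intro pick) simp
      moreover have "F |\<subseteq>| M" using M(2) F by (rule bspec)
      ultimately show ?thesis by (rule fsubsetD[rotated])
    qed
    then have "\<iota> b ` \<sigma> \<subseteq> fset M"
      unfolding C(1) image_image by (rule image_subsetI)
    moreover have "\<iota> b ` \<sigma> \<noteq> {}" using C by auto
    ultimately show "\<iota> b ` \<sigma> \<in> simplices (Sd b K)"
      using ordered_complex_face[OF ordered_complex_Sd[OF assms, of b]] C(4) M(1) by blast
  qed
  moreover have "\<iota> b (Barycentre F) |\<in>| F" if "Barycentre F \<in> vertices (Sd (Suc b) K)" for b F
    using that by (intro pick) (auto simp: Sd_def sd_def vertices_def)
  ultimately show ?thesis unfolding sd_approximations_def by blast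
qed

end

theory Submission
  imports Defs
begin

text \<open>Part (b) holds by definition. For (a), a motion planner on \<open>U\<close> is the same as a homotopy between
  the two projections on \<open>U\<close>, and both \<open>SimpD\<close> and \<open>TC\<close> are least numbers \<open>k\<close> admitting a cover.

  Given subcomplexes \<open>J\<^sub>i\<close> of \<open>Sd b (K \<times> K)\<close> with contiguous projections, subdivide once more, so that
  they become full. A continuous family of nonnegative weights, depending on a point \<open>(p, q)\<close> and
  supported on a simplex of the subdivision lying over the supports of \<open>p\<close> and \<open>q\<close>, replaces the
  homeomorphism from \<open>\<parallel>K\<parallel> \<times> \<parallel>K\<parallel>\<close> to \<open>\<parallel>Sd b (K \<times> K)\<parallel>\<close>. Where the total weight on \<open>J\<^sub>i\<close> is
  positive, normalising the restricted weights retracts onto \<open>J\<^sub>i\<close>, and the contiguity chain becomes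
  a chain of linear homotopies.

  Conversely, let \<open>h\<close> be a homotopy between the projections on an open set \<open>U\<close> and \<open>A \<subseteq> U\<close> compact.
  By Lebesgue's lemma, for a fine subdivision and a fine partition \<open>t\<^sub>j\<close> of the unit interval, each
  vertex \<open>v\<close> over \<open>A\<close> can be sent to a vertex \<open>H\<^sub>j v\<close> of \<open>K\<close> whose open star contains \<open>h (t, w)\<close> for
  all \<open>t\<close> between \<open>t\<^sub>j\<close> and \<open>t\<^sub>j\<^sub>+\<^sub>1\<close> and all \<open>w\<close> near \<open>v\<close>. Consecutive \<open>H\<^sub>j\<close> are then contiguous, since
  both map a simplex with vertex \<open>w\<close> into the support of \<open>h (t\<^sub>j\<^sub>+\<^sub>1, w)\<close>.\<close>

section \<open>Covers by subcomplexes and their subdivision\<close>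

lemma least_or_infinity_eq:
  assumes "P m" "\<And>k. P k \<Longrightarrow> m \<le> k"
  shows "least_or_infinity P = enat m"
  using assms unfolding least_or_infinity_def by (auto intro: Least_equality)

text \<open>Once the smallest \<open>k\<close> that works for some \<open>n\<close> is attained,
  monotonicity keeps it attained for every larger \<open>n\<close>, so the sequence is constant from
  there on. Used for \<open>c\<close> and then for \<open>b\<close>, this replaces the nested stable
  values by one minimum over \<open>k\<close> with \<open>b\<close> and \<open>c\<close>
  existentially quantified.\<close>

lemma stable_value_least_or_infinity:
  assumes mono: "\<And>n k. P n k \<Longrightarrow> P (Suc n) k"
  shows "stable_value (\<lambda>n. least_or_infinity (P n)) = least_or_infinity (\<lambda>k. \<exists>n. P n k)"
proof (cases "\<exists>k n. P n k")
  case True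
  define m where "m = (LEAST k. \<exists>n. P n k)"
  obtain n where n: "P n m"
    using LeastI_ex[OF True] unfolding m_def by blast
  have least: "m \<le> k" if "P n k" for n k
    unfolding m_def using that by (blast intro: Least_le)
  have up: "P n' m" if "n \<le> n'" for n'
    using that by (induction n' rule: dec_induct) (use n mono in auto)
  have "\<forall>\<^sub>F n' in sequentially. least_or_infinity (P n') = enat m"
    unfolding eventually_sequentially using up least by (blast intro: least_or_infinity_eq)
  moreover have "least_or_infinity (\<lambda>k. \<exists>n. P n k) = enat m"
    using n least by (blast intro: least_or_infinity_eq)
  ultimately show ?thesis by (simp add: stable_value_eq)
next
  case False
  then have "\<And>n. least_or_infinity (P n) = \<infinity>" "least_or_infinity (\<lambda>k. \<exists>n. P n k) = \<infinity>"
    by (auto simp: least_or_infinity_def)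
  then show ?thesis by (simp add: stable_value_eq)
qed

section \<open>Elementary facts on simplices and contiguity chains\<close>

lemma ordered_complex_finite: "ordered_complex K \<Longrightarrow> \<sigma> \<in> simplices K \<Longrightarrow> finite \<sigma>"
  and ordered_complex_nonempty: "ordered_complex K \<Longrightarrow> \<sigma> \<in> simplices K \<Longrightarrow> \<sigma> \<noteq> {}"
  by (auto simp: ordered_complex_def)

lemma singleton_simplex: "ordered_complex K \<Longrightarrow> v \<in> vertices K \<Longrightarrow> {v} \<in> simplices K"
  by (auto simp: vertices_def intro: ordered_complex_face)

lemma simplex_subset_vertices: "\<sigma> \<in> simplices K \<Longrightarrow> \<sigma> \<subseteq> vertices K"
  by (auto simp: vertices_def)

lemma simplicial_map_vertices:
  "simplicial_map K L f \<Longrightarrow> v \<in> vertices K \<Longrightarrow> f v \<in> vertices L"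
  unfolding simplicial_map_def vertices_def by blast

text \<open>The chain is prolonged by repeating its last map, since a simplicial map is contiguous
  to itself; \<open>min c i\<close> does the repeating.\<close>

lemma c_contiguous_Suc:
  assumes "c_contiguous c K L f g"
  shows "c_contiguous (Suc c) K L f g"
proof -
  obtain H where H: "\<And>i. i \<le> c \<Longrightarrow> simplicial_map K L (H i)" "\<forall>v\<in>vertices K. H 0 v = f v"
    "\<forall>v\<in>vertices K. H c v = g v" "\<And>i. i \<in> {1..c} \<Longrightarrow> contiguous K L (H (i - 1)) (H i)"
    using assms unfolding c_contiguous_def by blast
  have "contiguous K L (H c) (H c)"
    using H(1)[of c] by (simp add: contiguous_def simplicial_map_def)
  then have "contiguous K L (H (min c (i - 1))) (H (min c i))" if "i \<in> {1..Suc c}" for i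
    using that H(4)[of i] by (cases "i \<le> c") (auto simp: min_absorb1 min_absorb2 le_Suc_eq)
  then show ?thesis
    unfolding c_contiguous_def using H(1-3) by (intro exI[of _ "\<lambda>i. H (min c i)"]) auto
qed

lemma c_contiguous_mono:
  assumes "c_contiguous c K L f g" "c \<le> d"
  shows "c_contiguous d K L f g"
  using assms(2) by (induction d rule: dec_induct) (simp_all add: assms(1) c_contiguous_Suc)

lemma c_contiguous_compose:
  assumes "c_contiguous c K L f g" and h: "simplicial_map M K h"
  shows "c_contiguous c M L (f \<circ> h) (g \<circ> h)"
proof -
  obtain H where H: "\<forall>i\<le>c. simplicial_map K L (H i)" "\<forall>v\<in>vertices K. H 0 v = f v"
    "\<forall>v\<in>vertices K. H c v = g v" "\<forall>i\<in>{1..c}. contiguous K L (H (i - 1)) (H i)"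
    using assms unfolding c_contiguous_def by blast
  show ?thesis
    unfolding c_contiguous_def
  proof (intro exI[of _ "\<lambda>i. H i \<circ> h"] conjI)
    show "\<forall>i\<le>c. simplicial_map M L (H i \<circ> h)"
      using H(1) h unfolding simplicial_map_def image_comp[symmetric] by blast
    show "\<forall>i\<in>{1..c}. contiguous M L (H (i - 1) \<circ> h) (H i \<circ> h)"
      using H(4) h unfolding contiguous_def simplicial_map_def image_comp[symmetric] by blast
    show "\<forall>v\<in>vertices M. (H 0 \<circ> h) v = (f \<circ> h) v" "\<forall>v\<in>vertices M. (H c \<circ> h) v = (g \<circ> h) v"
      using H(2,3) simplicial_map_vertices[OF h] by simp_all
  qed
qed

section \<open>Chains of simplices and subdivided subcomplexes\<close>

lemma Sd_Suc: "Sd (Suc b) K = sd (Sd b K)"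
  by (simp add: Sd_def)

text \<open>The rule also supplies the greatest element \<open>M\<close> of the chain: most
  arguments on subdivisions below reduce a statement about the whole chain to one about
  \<open>M\<close>.\<close>

lemma simplices_sdE:
  assumes "\<sigma> \<in> simplices (sd K)"
  obtains C M where "\<sigma> = Barycentre ` C" "finite C" "\<forall>F\<in>C. fset F \<in> simplices K"
    "\<forall>F\<in>C. \<forall>G\<in>C. F |\<subseteq>| G \<or> G |\<subseteq>| F" "M \<in> C" "\<forall>F\<in>C. F |\<subseteq>| M"
proof -
  obtain C where C: "\<sigma> = Barycentre ` C" "finite C" "C \<noteq> {}"
    "\<forall>F\<in>C. fset F \<in> simplices K" "\<forall>F\<in>C. \<forall>G\<in>C. F |\<subseteq>| G \<or> G |\<subseteq>| F"
    using assms unfolding sd_def by simp blast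
  obtain M where "M \<in> C" "\<forall>F\<in>C. M \<le> F \<longrightarrow> M = F"
    using finite_has_maximal[OF C(2,3)] by blast
  then have M: "M \<in> C" "\<forall>F\<in>C. F |\<subseteq>| M"
    using C(5) by (blast, metis order_refl)
  show ?thesis by (rule that[OF C(1,2,4,5) M])
qed

lemma simplices_sdI:
  assumes "finite C" "C \<noteq> {}" "\<And>F. F \<in> C \<Longrightarrow> fset F \<in> simplices K"
    "\<And>F G. F \<in> C \<Longrightarrow> G \<in> C \<Longrightarrow> F |\<subseteq>| G \<or> G |\<subseteq>| F"
  shows "Barycentre ` C \<in> simplices (sd K)"
proof -
  have "finite C \<and> C \<noteq> {} \<and> (\<forall>F\<in>C. fset F \<in> simplices K) \<and> (\<forall>F\<in>C. \<forall>G\<in>C. F |\<subseteq>| G \<or> G |\<subseteq>| F)"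
    using assms by blast
  then show ?thesis unfolding sd_def by auto
qed

lemma vertices_sd: "vertices (sd K) = {Barycentre F |F. fset F \<in> simplices K}"
proof (rule antisym; rule subsetI)
  fix x assume "x \<in> {Barycentre F |F. fset F \<in> simplices K}"
  then obtain F where F: "x = Barycentre F" "fset F \<in> simplices K" by auto
  then show "x \<in> vertices (sd K)"
    using simplices_sdI[of "{F}" K] by (auto simp: vertices_def)
qed (auto simp: vertices_def sd_def)

lemma subcomplex_sd:
  assumes "subcomplex J K"
  shows "subcomplex (sd J) (sd K)"
proof -
  have "simplices J \<subseteq> simplices K"
    using assms by (simp add: subcomplex_def)
  have "simplices (sd J) \<subseteq> simplices (sd K)"
  proof
    fix \<sigma> assume "\<sigma> \<in> simplices (sd J)"
    then show "\<sigma> \<in> simplices (sd K)"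
    proof (rule simplices_sdE)
      fix C M assume "\<sigma> = Barycentre ` C" "finite C" "\<forall>F\<in>C. fset F \<in> simplices J"
        "\<forall>F\<in>C. \<forall>G\<in>C. F |\<subseteq>| G \<or> G |\<subseteq>| F" "M \<in> C"
      then show ?thesis
        using \<open>simplices J \<subseteq> simplices K\<close> simplices_sdI[of C K] by blast
    qed
  qed
  moreover have "vorder (sd J) = Restr (vorder (sd K)) (vertices (sd J))"
    using \<open>simplices J \<subseteq> simplices K\<close> unfolding vertices_sd by (auto simp: sd_def)
  ultimately show ?thesis
    by (simp add: subcomplex_def ordered_complex_sd)
qed

text \<open>A subcomplex containing the greatest element of a chain contains its other elements too,
  because they are faces of it.\<close>

lemma covers_sd:
  assumes "covers J I K" "\<And>i. i \<in> I \<Longrightarrow> subcomplex (J i) K"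
  shows "covers (\<lambda>i. sd (J i)) I (sd K)"
proof -
  have sub: "simplices (sd (J i)) \<subseteq> simplices (sd K)" if "i \<in> I" for i
    using subcomplex_sd[OF assms(2)[OF that]] by (simp add: subcomplex_def)
  have "\<exists>i\<in>I. \<sigma> \<in> simplices (sd (J i))" if \<sigma>: "\<sigma> \<in> simplices (sd K)" for \<sigma>
  proof -
    obtain C M where C: "\<sigma> = Barycentre ` C" "finite C" "\<forall>F\<in>C. fset F \<in> simplices K"
      "\<forall>F\<in>C. \<forall>G\<in>C. F |\<subseteq>| G \<or> G |\<subseteq>| F" "M \<in> C" "\<forall>F\<in>C. F |\<subseteq>| M"
      using \<sigma> by (rule simplices_sdE)
    obtain i where i: "i \<in> I" "fset M \<in> simplices (J i)"
      using assms(1) C(3,5) unfolding covers_def by blast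
    have J: "ordered_complex (J i)" using assms(2) i by (simp add: subcomplex_def)
    have "fset F \<in> simplices (J i)" if F: "F \<in> C" for F
    proof (rule ordered_complex_face[OF J i(2)])
      show "fset F \<subseteq> fset M" using bspec[OF C(6) F] by (simp add: less_eq_fset.rep_eq)
      obtain i' where "i' \<in> I" "fset F \<in> simplices (J i')"
        using assms(1) C(3) F unfolding covers_def by blast
      then show "fset F \<noteq> {}"
        using assms(2) by (auto simp: subcomplex_def ordered_complex_def)
    qed
    then have "\<sigma> \<in> simplices (sd (J i))"
      unfolding C(1) using C(2,4,5) by (intro simplices_sdI) blast+
    then show ?thesis using i(1) by blast
  qed
  with sub show ?thesis unfolding covers_def by blast
qed

text \<open>A vertex of \<open>sd J\<close> is by itself a simplex of \<open>J\<close>, and the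
  chain condition is inherited from \<open>\<sigma>\<close>. Fullness is the reason for subdividing
  once more: the part of a simplex that lies over \<open>J\<close> is then one simplex.\<close>

lemma sd_subcomplex_full:
  assumes "\<sigma> \<in> simplices (sd K)" "\<tau> \<subseteq> \<sigma>" "\<tau> \<noteq> {}" "\<tau> \<subseteq> vertices (sd J)"
  shows "\<tau> \<in> simplices (sd J)"
proof -
  obtain C M where C: "\<sigma> = Barycentre ` C" "finite C" "\<forall>F\<in>C. fset F \<in> simplices K"
    "\<forall>F\<in>C. \<forall>G\<in>C. F |\<subseteq>| G \<or> G |\<subseteq>| F" "M \<in> C" "\<forall>F\<in>C. F |\<subseteq>| M"
    using assms(1) by (rule simplices_sdE)
  obtain D where D: "D \<subseteq> C" "\<tau> = Barycentre ` D"
    using assms(2) C(1) by (auto simp: subset_image_iff)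
  show ?thesis
    unfolding D(2)
  proof (rule simplices_sdI)
    show "finite D" using D(1) C(2) by (rule finite_subset)
    show "D \<noteq> {}" using assms(3) D(2) by auto
    show "F |\<subseteq>| G \<or> G |\<subseteq>| F" if "F \<in> D" "G \<in> D" for F G using that C(4) D(1) by blast
    show "fset F \<in> simplices J" if "F \<in> D" for F
      using assms(4) that unfolding vertices_sd D(2) by blast
  qed
qed

text \<open>Each \<open>F\<close> in the chain is sent to an element of \<open>F\<close>, hence of
  the greatest element \<open>M\<close>; so the image is a face of \<open>M\<close>, which belongs
  to \<open>J\<close>.\<close>

lemma simplicial_map_sd_subcomplex:
  assumes \<iota>: "sd_approximations K \<iota>" and J: "subcomplex J (Sd b K)"
  shows "simplicial_map (sd J) J (\<iota> b)"
  unfolding simplicial_map_def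
proof
  fix \<sigma> assume "\<sigma> \<in> simplices (sd J)"
  then obtain C M where C: "\<sigma> = Barycentre ` C" "finite C" "\<forall>F\<in>C. fset F \<in> simplices J"
    "\<forall>F\<in>C. \<forall>G\<in>C. F |\<subseteq>| G \<or> G |\<subseteq>| F" "M \<in> C" "\<forall>F\<in>C. F |\<subseteq>| M"
    by (rule simplices_sdE)
  have "\<iota> b (Barycentre F) \<in> fset M" if F: "F \<in> C" for F
  proof -
    have "Barycentre F \<in> vertices (Sd (Suc b) K)"
      using bspec[OF C(3) F] J unfolding Sd_Suc vertices_sd subcomplex_def by blast
    then show ?thesis
      using \<iota> bspec[OF C(6) F] unfolding sd_approximations_def by (meson less_eq_fset.rep_eq subsetD)
  qed
  then have "\<iota> b ` \<sigma> \<subseteq> fset M" unfolding C(1) by blast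
  moreover have "\<iota> b ` \<sigma> \<noteq> {}" using C(1,5) by blast
  ultimately show "\<iota> b ` \<sigma> \<in> simplices J"
    using ordered_complex_face[of J "fset M" "\<iota> b ` \<sigma>"] J C(3,5) unfolding subcomplex_def by blast
qed

definition contiguity_cover ::
  "'a ocomplex \<Rightarrow> 'b ocomplex \<Rightarrow> (nat \<Rightarrow> 'a sd_vertex \<Rightarrow> 'a sd_vertex)
    \<Rightarrow> ('a \<Rightarrow> 'b) \<Rightarrow> ('a \<Rightarrow> 'b) \<Rightarrow> nat \<Rightarrow> nat \<Rightarrow> nat \<Rightarrow> (nat \<Rightarrow> 'a sd_vertex ocomplex) \<Rightarrow> bool" where
  "contiguity_cover K L \<iota> \<phi> \<psi> b c k J \<longleftrightarrow>
     (\<forall>i\<le>k. subcomplex (J i) (Sd b K)) \<and> covers J {..k} (Sd b K) \<and>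
     (\<forall>i\<le>k. c_contiguous c (J i) L (\<phi> \<circ> sd_to_base \<iota> b) (\<psi> \<circ> sd_to_base \<iota> b))"

lemma contiguity_cover_Suc_c:
  "contiguity_cover K L \<iota> \<phi> \<psi> b c k J \<Longrightarrow> contiguity_cover K L \<iota> \<phi> \<psi> b (Suc c) k J"
  by (simp add: contiguity_cover_def c_contiguous_Suc)

text \<open>Subdivide every member of the cover and precompose the contiguity chains with
  \<open>\<iota> b\<close>. This gives monotonicity in \<open>b\<close>, and it also produces covers
  by full subcomplexes.\<close>

lemma contiguity_cover_sd:
  assumes \<iota>: "sd_approximations K \<iota>" and J: "contiguity_cover K L \<iota> \<phi> \<psi> b c k J"
  shows "contiguity_cover K L \<iota> \<phi> \<psi> (Suc b) c k (\<lambda>i. sd (J i))"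
  unfolding contiguity_cover_def
proof (intro conjI allI impI)
  fix i assume i: "i \<le> k"
  have sub: "subcomplex (J i) (Sd b K)"
    using J i by (simp add: contiguity_cover_def)
  then show "subcomplex (sd (J i)) (Sd (Suc b) K)"
    by (simp add: Sd_Suc subcomplex_sd)
  have "c_contiguous c (J i) L (\<phi> \<circ> sd_to_base \<iota> b) (\<psi> \<circ> sd_to_base \<iota> b)"
    using J i by (simp add: contiguity_cover_def)
  from c_contiguous_compose[OF this simplicial_map_sd_subcomplex[OF \<iota> sub]]
  show "c_contiguous c (sd (J i)) L (\<phi> \<circ> sd_to_base \<iota> (Suc b)) (\<psi> \<circ> sd_to_base \<iota> (Suc b))"
    unfolding sd_to_base.simps comp_assoc .
next
  show "covers (\<lambda>i. sd (J i)) {..k} (Sd (Suc b) K)"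
    unfolding Sd_Suc
  proof (rule covers_sd)
    show "covers J {..k} (Sd b K)" using J by (simp add: contiguity_cover_def)
    show "subcomplex (J i) (Sd b K)" if "i \<in> {..k}" for i
      using J that by (simp add: contiguity_cover_def)
  qed
qed

lemma SimpD_eq_least:
  assumes "sd_approximations K \<iota>"
  shows "SimpD K L \<iota> \<phi> \<psi> = least_or_infinity (\<lambda>k. \<exists>b c J. contiguity_cover K L \<iota> \<phi> \<psi> b c k J)"
proof -
  have "SimpD_b K L \<iota> b \<phi> \<psi> = least_or_infinity (\<lambda>k. \<exists>c J. contiguity_cover K L \<iota> \<phi> \<psi> b c k J)" for b
    unfolding SimpD_b_def SimpD_bc_def contiguity_cover_def[symmetric]
    by (rule stable_value_least_or_infinity) (blast intro: contiguity_cover_Suc_c)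
  then show ?thesis
    unfolding SimpD_def
    by (simp, intro stable_value_least_or_infinity) (blast intro: contiguity_cover_sd[OF assms])
qed

section \<open>Geometric realizations of finite complexes\<close>

definition realization_points :: "'a ocomplex \<Rightarrow> ('a \<Rightarrow> real) set" where
  "realization_points K = (\<Union>\<sigma>\<in>simplices K. closed_simplex \<sigma>)"

definition support :: "('a \<Rightarrow> real) \<Rightarrow> 'a set" where
  "support x = {v. x v \<noteq> 0}"

lemma topspace_realization [simp]: "topspace (geometric_realization K) = realization_points K"
  by (simp add: topspace_geometric_realization realization_points_def)

lemma closed_simplexI:
  assumes "\<And>v. 0 \<le> x v" "support x \<subseteq> \<sigma>" "sum x (support x) = 1" "finite \<sigma>"
  shows "x \<in> closed_simplex \<sigma>"
proof -
  have "sum x \<sigma> = sum x (support x)"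
    using assms(2,4) by (intro sum.mono_neutral_right) (auto simp: support_def)
  then show ?thesis using assms by (auto simp: closed_simplex_def support_def)
qed

lemma closed_simplex_nonneg: "x \<in> closed_simplex \<sigma> \<Longrightarrow> 0 \<le> x v"
  and support_closed_simplex: "x \<in> closed_simplex \<sigma> \<Longrightarrow> support x \<subseteq> \<sigma>"
  and sum_closed_simplex: "x \<in> closed_simplex \<sigma> \<Longrightarrow> sum x \<sigma> = 1"
  by (auto simp: closed_simplex_def support_def)

lemma closed_simplex_le_1:
  assumes "x \<in> closed_simplex \<sigma>" shows "x v \<le> 1"
proof (cases "v \<in> \<sigma>")
  case True
  \<comment> \<open>A sum over an infinite set is 0 by convention, so coordinate sum 1 forces the
    simplex to be finite.\<close>
  have "finite \<sigma>" using sum_closed_simplex[OF assms] by (metis sum.infinite zero_neq_one)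
  then show ?thesis
    using member_le_sum[of v \<sigma> x] True closed_simplex_nonneg[OF assms] sum_closed_simplex[OF assms] by auto
qed (use assms in \<open>auto simp: closed_simplex_def\<close>)

lemma sum_support_closed_simplex:
  assumes "x \<in> closed_simplex \<sigma>"
  shows "sum x (support x) = 1"
proof -
  have "finite \<sigma>" using sum_closed_simplex[OF assms] by (metis sum.infinite zero_neq_one)
  then have "sum x \<sigma> = sum x (support x)"
    using support_closed_simplex[OF assms] by (intro sum.mono_neutral_right) (auto simp: support_def)
  then show ?thesis using sum_closed_simplex[OF assms] by simp
qed

lemma realization_pointsE:
  assumes "x \<in> realization_points K"
  obtains \<sigma> where "\<sigma> \<in> simplices K" "x \<in> closed_simplex \<sigma>"
  using assms unfolding realization_points_def by blast

lemma support_nonempty: "x \<in> realization_points K \<Longrightarrow> support x \<noteq> {}"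
  by (erule realization_pointsE) (metis sum_support_closed_simplex sum.empty zero_neq_one)

lemma support_simplex:
  assumes K: "ordered_complex K" and "x \<in> realization_points K"
  shows "support x \<in> simplices K"
  using assms(2)
  by (rule realization_pointsE)
     (use ordered_complex_face[OF K _ support_closed_simplex support_nonempty[OF assms(2)]] in blast)

lemma realization_points_in_support:
  assumes K: "ordered_complex K" and x: "x \<in> realization_points K"
  shows "x \<in> closed_simplex (support x)"
proof -
  obtain \<sigma> where \<sigma>: "\<sigma> \<in> simplices K" "x \<in> closed_simplex \<sigma>"
    using x by (rule realization_pointsE)
  have "finite (support x)"
    using support_simplex[OF assms] K by (simp add: ordered_complex_def)
  then show ?thesis
    using sum_support_closed_simplex[OF \<sigma>(2)] closed_simplex_nonneg[OF \<sigma>(2)]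
    by (auto intro: closed_simplexI)
qed

lemma closed_simplex_mono:
  assumes "\<sigma> \<subseteq> \<tau>" "finite \<tau>"
  shows "closed_simplex \<sigma> \<subseteq> closed_simplex \<tau>"
proof
  fix x assume x: "x \<in> closed_simplex \<sigma>"
  show "x \<in> closed_simplex \<tau>"
    using support_closed_simplex[OF x] assms(1)
    by (intro closed_simplexI closed_simplex_nonneg[OF x] sum_support_closed_simplex[OF x] assms(2)) simp
qed

lemma closed_simplex_convex:
  assumes "x \<in> closed_simplex \<sigma>" "y \<in> closed_simplex \<sigma>" "0 \<le> t" "t \<le> 1"
  shows "(\<lambda>v. (1 - t) * x v + t * y v) \<in> closed_simplex \<sigma>"
  using assms by (auto simp: closed_simplex_def sum.distrib sum_distrib_left[symmetric])

lemma closed_closed_simplex: "closed (closed_simplex \<sigma>)"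
proof -
  have "closed_simplex \<sigma> = (\<Inter>v. {x. 0 \<le> x v}) \<inter> (\<Inter>v\<in>-\<sigma>. {x. x v = 0}) \<inter> {x. (\<Sum>v\<in>\<sigma>. x v) = 1}"
    by (auto simp: closed_simplex_def)
  moreover have "closed {x::'a \<Rightarrow> real. 0 \<le> x v}" "closed {x::'a \<Rightarrow> real. x v = 0}" for v
    by (intro closed_Collect_le closed_Collect_eq continuous_intros continuous_on_product_coordinates)+
  moreover have "closed {x::'a \<Rightarrow> real. (\<Sum>v\<in>\<sigma>. x v) = 1}"
    by (intro closed_Collect_eq continuous_intros continuous_on_product_coordinates)
  ultimately show ?thesis by (auto intro!: closed_Int closed_INT)
qed

lemma closed_realization_points: "finite_complex K \<Longrightarrow> closed (realization_points K)"
  unfolding realization_points_def finite_complex_def by (simp add: closed_UN closed_closed_simplex)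

text \<open>A closed subset of a cube \<open>[0, 1]\<close> to the power of the whole vertex type,
  which is compact by Tychonoff even when that type is infinite.\<close>

lemma compact_realization_points:
  assumes "finite_complex K"
  shows "compact (realization_points K)"
proof -
  have "compactin (powertop_real UNIV) (PiE UNIV (\<lambda>_::'a. {0..1::real}))"
    by (subst compactin_PiE) simp
  then have "compact (PiE UNIV (\<lambda>_::'a. {0..1::real}))"
    by (simp add: euclidean_product_topology)
  moreover have "realization_points K \<subseteq> PiE UNIV (\<lambda>_. {0..1})"
  proof
    fix x assume "x \<in> realization_points K"
    then obtain \<sigma> where "x \<in> closed_simplex \<sigma>" by (rule realization_pointsE)
    then show "x \<in> PiE UNIV (\<lambda>_. {0..1})"
      by (auto simp: closed_simplex_nonneg closed_simplex_le_1)
  qed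
  ultimately show ?thesis
    using compact_Int_closed[OF _ closed_realization_points[OF assms], of "PiE UNIV (\<lambda>_. {0..1})"]
    by (simp add: inf.absorb2)
qed

text \<open>If \<open>S\<close> is open in the coherent topology, its complement is the union of the
  closed sets \<open>closed_simplex \<sigma> - S\<close>; there are finitely many, so the union is
  closed.\<close>

lemma geometric_realization_eq:
  assumes "finite_complex K"
  shows "geometric_realization K = top_of_set (realization_points K)"
proof (rule topology_eq[THEN iffD2], intro allI iffI)
  fix S assume S: "openin (top_of_set (realization_points K)) S"
  then obtain T where "open T" "S = realization_points K \<inter> T" by (auto simp: openin_open)
  then show "openin (geometric_realization K) S"
    unfolding openin_geometric_realization euclidean_product_topology openin_open
    by (auto simp: realization_points_def)
next
  fix S assume "openin (geometric_realization K) S"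
  then have S: "S \<subseteq> realization_points K"
    "\<And>\<sigma>. \<sigma> \<in> simplices K \<Longrightarrow> openin (top_of_set (closed_simplex \<sigma>)) (S \<inter> closed_simplex \<sigma>)"
    unfolding openin_geometric_realization euclidean_product_topology realization_points_def by auto
  have "closed (closed_simplex \<sigma> - S)" if "\<sigma> \<in> simplices K" for \<sigma>
  proof -
    have "closedin (top_of_set (closed_simplex \<sigma>)) (closed_simplex \<sigma> - (S \<inter> closed_simplex \<sigma>))"
      using S(2)[OF that] by (intro closedin_diff) auto
    then have "closed (closed_simplex \<sigma> - (S \<inter> closed_simplex \<sigma>))"
      using closed_closed_simplex closedin_closed_trans by blast
    moreover have "closed_simplex \<sigma> - (S \<inter> closed_simplex \<sigma>) = closed_simplex \<sigma> - S" by blast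
    ultimately show ?thesis by simp
  qed
  then have "closed (\<Union>\<sigma>\<in>simplices K. closed_simplex \<sigma> - S)"
    using assms by (intro closed_UN) (auto simp: finite_complex_def)
  moreover have "S = realization_points K \<inter> - (\<Union>\<sigma>\<in>simplices K. closed_simplex \<sigma> - S)"
    using S(1) by (auto simp: realization_points_def)
  ultimately show "openin (top_of_set (realization_points K)) S"
    unfolding openin_open open_closed
    by (intro exI[of _ "- (\<Union>\<sigma>\<in>simplices K. closed_simplex \<sigma> - S)"] conjI) (simp_all only: double_complement)
qed

lemma continuous_map_realization_iff:
  assumes "finite_complex K"
  shows "continuous_map T (geometric_realization K) f \<longleftrightarrow>
    (\<forall>a. continuous_map T euclideanreal (\<lambda>x. f x a)) \<and> f \<in> topspace T \<rightarrow> realization_points K"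
  unfolding geometric_realization_eq[OF assms] continuous_map_in_subtopology
  by (simp add: euclidean_product_topology[symmetric] continuous_map_componentwise_UNIV)

lemma continuous_map_coordinate:
  assumes "finite_complex K"
  shows "continuous_map (geometric_realization K) euclideanreal (\<lambda>x. x a)"
  using continuous_map_realization_iff[OF assms, of "geometric_realization K" id] by simp

section \<open>Homotopies and motion planners\<close>

text \<open>The straight-line homotopy stays in the realization because both endpoints lie in a
  common closed simplex, which is convex.\<close>

lemma homotopic_linear:
  assumes K: "finite_complex K"
    and f: "continuous_map T (geometric_realization K) f"
    and g: "continuous_map T (geometric_realization K) g"
    and fg: "\<And>x. x \<in> topspace T \<Longrightarrow> \<exists>\<sigma>\<in>simplices K. f x \<in> closed_simplex \<sigma> \<and> g x \<in> closed_simplex \<sigma>"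
  shows "homotopic_with (\<lambda>_. True) T (geometric_realization K) f g"
proof -
  let ?h = "\<lambda>z v. (1 - fst z) * f (snd z) v + fst z * g (snd z) v"
  have fa: "continuous_map T euclideanreal (\<lambda>x. f x a)" "continuous_map T euclideanreal (\<lambda>x. g x a)" for a
    using f g continuous_map_realization_iff[OF K] by blast+
  have t: "continuous_map (prod_topology (top_of_set {0..1}) T) euclideanreal fst"
    using continuous_map_fst continuous_map_into_fulltopology by blast
  have "continuous_map (prod_topology (top_of_set {0..1}) T) euclideanreal (\<lambda>z. ?h z a)" for a
    using continuous_map_compose[OF continuous_map_snd fa(1)] continuous_map_compose[OF continuous_map_snd fa(2)]
    by (intro continuous_map_add continuous_map_real_mult continuous_map_diff t) (auto simp: o_def)
  moreover have "?h z \<in> realization_points K" if z: "z \<in> topspace (prod_topology (top_of_set {0..1::real}) T)" for z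
  proof -
    obtain \<sigma> where "\<sigma> \<in> simplices K" "f (snd z) \<in> closed_simplex \<sigma>" "g (snd z) \<in> closed_simplex \<sigma>"
      using fg[of "snd z"] z by auto
    then show ?thesis
      using closed_simplex_convex[of "f (snd z)" \<sigma> "g (snd z)" "fst z"] z by (auto simp: realization_points_def)
  qed
  ultimately have "continuous_map (prod_topology (top_of_set {0..1}) T) (geometric_realization K) ?h"
    unfolding continuous_map_realization_iff[OF K] by blast
  then show ?thesis
    unfolding homotopic_with_def by (intro exI[of _ ?h]) simp
qed

text \<open>Local compactness of the interval: if \<open>s z t\<close> lies in \<open>W\<close>,
  some compact neighbourhood \<open>C\<close> of \<open>t\<close> is mapped into \<open>W\<close> by
  \<open>s z\<close>, and the paths mapping \<open>C\<close> into \<open>W\<close> form a subbasic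
  open set.\<close>

lemma path_space_evaluation:
  assumes s: "continuous_map T (path_space X) s"
  shows "continuous_map (prod_topology (top_of_set {0..1}) T) X (\<lambda>(t, z). s z t)"
  unfolding continuous_map
proof (intro conjI allI impI)
  have paths: "s z \<in> paths X" if "z \<in> topspace T" for z
    using continuous_map_image_subset_topspace[OF s] that topspace_path_space[of X] by blast
  then have "s z t \<in> topspace X" if "z \<in> topspace T" "t \<in> {0..1}" for z t
    using path_image_subset_topspace[of X "s z"] that by (auto simp: paths_def)
  then show "(\<lambda>(t, z). s z t) ` topspace (prod_topology (top_of_set {0..1}) T) \<subseteq> topspace X"
    by auto
  fix W assume W: "openin X W"
  let ?P = "{z \<in> topspace (prod_topology (top_of_set {0..1}) T). (case z of (t, z) \<Rightarrow> s z t) \<in> W}"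
  show "openin (prod_topology (top_of_set {0..1}) T) ?P"
  proof (subst openin_subopen, rule ballI)
    fix p assume "p \<in> ?P"
    then obtain t z where p: "p = (t, z)" "t \<in> {0..1}" "z \<in> topspace T" "s z t \<in> W" by auto
    have "continuous_map (top_of_set {0..1}) X (s z)"
      using paths[OF p(3)] by (simp add: paths_def pathin_def)
    then have "openin (top_of_set {0..1}) {u \<in> topspace (top_of_set {0..1}). s z u \<in> W}"
      using W by (rule openin_continuous_map_preimage)
    moreover have "t \<in> {u \<in> topspace (top_of_set {0..1}). s z u \<in> W}" using p by simp
    ultimately obtain \<epsilon> where "\<epsilon> > 0" "cball t \<epsilon> \<inter> {0..1} \<subseteq> {u \<in> topspace (top_of_set {0..1}). s z u \<in> W}"
      unfolding openin_contains_cball by blast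
    then have \<epsilon>: "\<epsilon> > 0" "cball t \<epsilon> \<inter> {0..1} \<subseteq> {u. s z u \<in> W}" by auto
    let ?C = "cball t \<epsilon> \<inter> {0..1}"
    let ?V = "{z' \<in> topspace T. s z' \<in> {\<gamma> \<in> paths X. \<gamma> ` ?C \<subseteq> W}}"
    have "openin (path_space X) {\<gamma> \<in> paths X. \<gamma> ` ?C \<subseteq> W}"
      unfolding path_space_def
    proof (rule topology_generated_by_Basis, rule CollectI, intro exI conjI)
      show "compact ?C" by (intro compact_Int_closed) auto
    qed (use W in auto)
    then have "openin T ?V" using s by (intro openin_continuous_map_preimage)
    then have "openin (prod_topology (top_of_set {0..1}) T) ((ball t \<epsilon> \<inter> {0..1}) \<times> ?V)"
      by (simp add: openin_prod_Times_iff openin_open Int_commute exI[of _ "ball t \<epsilon>"])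
    moreover have "p \<in> (ball t \<epsilon> \<inter> {0..1}) \<times> ?V"
      using p \<epsilon> paths by auto
    moreover have "(ball t \<epsilon> \<inter> {0..1}) \<times> ?V \<subseteq> ?P"
      by (auto simp: image_subset_iff)
    ultimately show "\<exists>N. openin (prod_topology (top_of_set {0..1}) T) N \<and> p \<in> N \<and> N \<subseteq> ?P"
      by blast
  qed
qed

text \<open>Only subbasic open sets have to be tested. For compact \<open>C\<close> mapped into
  \<open>W\<close> at \<open>z\<close>, the tube lemma gives a neighbourhood of \<open>z\<close>
  where this persists.\<close>

lemma path_space_currying:
  assumes h: "continuous_map (prod_topology (top_of_set {0..1}) T) X h"
  shows "continuous_map T (path_space X) (\<lambda>z. restrict (\<lambda>t. h (t, z)) {0..1})"
    (is "continuous_map T _ ?s")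
proof -
  have paths: "?s z \<in> paths X" if z: "z \<in> topspace T" for z
  proof -
    have "continuous_map (top_of_set {0..1}) X (h \<circ> (\<lambda>t. (t, z)))"
      by (rule continuous_map_compose[OF _ h]) (use z in \<open>intro continuous_intros; simp\<close>)
    then have "continuous_map (top_of_set {0..1}) X (?s z)"
      by (rule continuous_map_eq) auto
    then show ?thesis by (simp add: paths_def pathin_def)
  qed
  have op: "openin T (?s -` B \<inter> topspace T)"
    if B: "B = {\<gamma> \<in> paths X. \<gamma> ` C \<subseteq> W}" and C: "compact C" "C \<subseteq> {0..1}" and W: "openin X W" for B C W
  proof (subst openin_subopen, rule ballI)
    fix z assume z: "z \<in> ?s -` B \<inter> topspace T"
    let ?P = "{p \<in> topspace (prod_topology (top_of_set {0..1}) T). h p \<in> W}"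
    have "openin (prod_topology (top_of_set {0..1}) T) ?P"
      using h W by (rule openin_continuous_map_preimage)
    moreover have "compactin (top_of_set {0..1}) C"
      using C by (simp add: compactin_subtopology)
    moreover have "C \<times> {z} \<subseteq> ?P"
    proof
      fix p assume p: "p \<in> C \<times> {z}"
      then have "?s z (fst p) \<in> W" using z unfolding B by (auto simp: image_subset_iff simp del: restrict_apply)
      then show "p \<in> ?P" using p z C(2) by auto
    qed
    ultimately obtain U V where UV: "openin T V" "C \<subseteq> U" "z \<in> V" "U \<times> V \<subseteq> ?P"
      using tube_lemma_left[of "top_of_set {0..1}" T ?P C z] z by blast
    have "V \<subseteq> ?s -` B \<inter> topspace T"
    proof
      fix y assume y: "y \<in> V"
      then have "y \<in> topspace T" using openin_subset[OF UV(1)] by blast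
      moreover have "?s y t \<in> W" if "t \<in> C" for t
        using UV(2,4) y that C(2) by auto
      ultimately show "y \<in> ?s -` B \<inter> topspace T"
        using paths unfolding B by blast
    qed
    then show "\<exists>N. openin T N \<and> z \<in> N \<and> N \<subseteq> ?s -` B \<inter> topspace T" using UV by blast
  qed
  show ?thesis
    unfolding path_space_def
  proof (rule continuous_on_generated_topo)
    show "openin T (?s -` B \<inter> topspace T)"
      if "B \<in> {{\<gamma> \<in> paths X. \<gamma> ` C \<subseteq> W} |C W. compact C \<and> C \<subseteq> {0..1} \<and> openin X W}" for B
      using that op by blast
    have "?s ` topspace T \<subseteq> topspace (path_space X)"
      using paths by (auto simp: topspace_path_space)
    then show "?s ` topspace T \<subseteq> \<Union> {{\<gamma> \<in> paths X. \<gamma> ` C \<subseteq> W} |C W. compact C \<and> C \<subseteq> {0..1} \<and> openin X W}"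
      by (simp add: path_space_def)
  qed
qed

lemma has_motion_planner_iff_homotopic:
  assumes U: "U \<subseteq> topspace (prod_topology X X)"
  shows "has_motion_planner X U \<longleftrightarrow>
    homotopic_with (\<lambda>_. True) (subtopology (prod_topology X X) U) X fst snd"
proof -
  let ?T = "subtopology (prod_topology X X) U"
  have T: "topspace ?T = U" using U by (simp add: inf.absorb2)
  show ?thesis
  proof
    assume "has_motion_planner X U"
    then obtain s where s: "continuous_map ?T (path_space X) s" "\<And>p. p \<in> U \<Longrightarrow> path_fibration (s p) = p"
      unfolding has_motion_planner_def by blast
    show "homotopic_with (\<lambda>_. True) ?T X fst snd"
      \<comment> \<open>The section is constrained on \<open>U\<close> only, so the form of the
        definition is taken in which the two ends need to agree merely on the space.\<close>
      unfolding homotopic_with[of ?T "\<lambda>_. True", simplified T, OF refl]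
    proof (intro exI conjI ballI)
      show "continuous_map (prod_topology (top_of_set {0..1}) ?T) X (\<lambda>(t, z). s z t)"
        by (rule path_space_evaluation[OF s(1)])
      show "(case (0, p) of (t, z) \<Rightarrow> s z t) = fst p" "(case (1, p) of (t, z) \<Rightarrow> s z t) = snd p"
        if "p \<in> U" for p
        using s(2)[OF that] by (cases p, simp add: path_fibration_def)+
    qed simp
  next
    assume "homotopic_with (\<lambda>_. True) ?T X fst snd"
    then obtain h where h: "continuous_map (prod_topology (top_of_set {0..1::real}) ?T) X h"
      "\<forall>x. h (0, x) = fst x" "\<forall>x. h (1, x) = snd x"
      unfolding homotopic_with_def by metis
    show "has_motion_planner X U"
      unfolding has_motion_planner_def using path_space_currying[OF h(1)] h(2,3)
      by (intro exI[of _ "\<lambda>z. restrict (\<lambda>t. h (t, z)) {0..1}"]) (auto simp: path_fibration_def)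
  qed
qed

section \<open>Barycentric weights on products and subdivisions\<close>

lemma finite_chain_has_maximum:
  assumes "finite S" "S \<noteq> {}" "trans r" "\<forall>x\<in>S. \<forall>y\<in>S. x = y \<or> (x, y) \<in> r \<or> (y, x) \<in> r"
  shows "\<exists>m\<in>S. \<forall>x\<in>S. (x, m) \<in> r\<^sup>="
  using assms(1,2,4)
proof (induction S rule: finite_ne_induct)
  case (insert a S)
  then obtain m where m: "m \<in> S" "\<forall>x\<in>S. (x, m) \<in> r\<^sup>=" by auto
  show ?case
  proof (cases "(a, m) \<in> r\<^sup>=")
    case True
    then show ?thesis using m by (intro bexI[of _ m]) simp_all
  next
    case False
    then have "(m, a) \<in> r\<^sup>=" using insert.prems insert.hyps m(1) by auto
    moreover have "trans (r\<^sup>=)" using assms(3) by simp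
    ultimately have "\<forall>x\<in>S. (x, a) \<in> r\<^sup>=" using m(2) by (meson transD)
    then show ?thesis by (intro bexI[of _ a]) simp_all
  qed
qed simp

text \<open>Induction on cardinality: the maximum is removed, the rest enumerated, and the maximum
  appended at index \<open>Suc n\<close>.\<close>

lemma finite_chain_enumeration:
  assumes "finite S" "S \<noteq> {}" "trans r" "\<forall>x\<in>S. \<forall>y\<in>S. x = y \<or> (x, y) \<in> r \<or> (y, x) \<in> r"
  shows "\<exists>n f. S = f ` {..n::nat} \<and> (\<forall>i<n. (f i, f (Suc i)) \<in> r)"
  using assms(1,2,4)
proof (induction "card S" arbitrary: S)
  case (Suc k)
  obtain m where m: "m \<in> S" "\<forall>x\<in>S. (x, m) \<in> r\<^sup>="
    using finite_chain_has_maximum[OF Suc.prems(1,2) assms(3) Suc.prems(3)] by blast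
  show ?case
  proof (cases "S = {m}")
    case True
    then show ?thesis by (intro exI[of _ 0] exI[of _ "\<lambda>_. m"]) simp
  next
    case False
    have "card (S - {m}) = k" using Suc.hyps(2) Suc.prems(1) m(1) by simp
    then have "\<exists>n f. S - {m} = f ` {..n::nat} \<and> (\<forall>i<n. (f i, f (Suc i)) \<in> r)"
      using Suc.prems m(1) False by (intro Suc.hyps(1)) auto
    then obtain n and f :: "nat \<Rightarrow> 'a" where f: "S - {m} = f ` {..n}" "\<forall>i<n. (f i, f (Suc i)) \<in> r"
      by blast
    have "f n \<in> S - {m}" using f(1) by simp
    then have "(f n, m) \<in> r" using m(2) by blast
    then have "\<forall>i<Suc n. ((f(Suc n := m)) i, (f(Suc n := m)) (Suc i)) \<in> r"
      using f(2) by (simp add: less_Suc_eq)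
    moreover have "(f(Suc n := m)) ` {..n} = f ` {..n}"
      by (intro image_cong) auto
    then have "(f(Suc n := m)) ` {..Suc n} = insert m (S - {m})"
      by (simp only: atMost_Suc image_insert f(1) fun_upd_same)
    then have "S = (f(Suc n := m)) ` {..Suc n}"
      using m(1) by (simp only: insert_Diff)
    ultimately show ?thesis by blast
  qed
qed simp

lemma vorder_refl: "ordered_complex K \<Longrightarrow> v \<in> vertices K \<Longrightarrow> (v, v) \<in> vorder K"
  by (auto simp: ordered_complex_def partial_order_on_def preorder_on_def refl_on_def)

lemma vorder_trans: "ordered_complex K \<Longrightarrow> trans (vorder K)"
  and vorder_antisym: "ordered_complex K \<Longrightarrow> antisym (vorder K)"
  by (auto simp: ordered_complex_def partial_order_on_def preorder_on_def)

lemma simplex_total: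
  "ordered_complex K \<Longrightarrow> \<sigma> \<in> simplices K \<Longrightarrow> u \<in> \<sigma> \<Longrightarrow> v \<in> \<sigma> \<Longrightarrow> u = v \<or> (u, v) \<in> vorder K \<or> (v, u) \<in> vorder K"
  unfolding ordered_complex_def total_on_def by blast

lemma vorder_prod: "((v, w), (v', w')) \<in> vorder (K \<times>\<^sub>o L) \<longleftrightarrow> (v, v') \<in> vorder K \<and> (w, w') \<in> vorder L"
  by (simp add: prod_complex_def)

lemma fst_simplex_prod: "\<sigma> \<in> simplices (K \<times>\<^sub>o L) \<Longrightarrow> fst ` \<sigma> \<in> simplices K"
  and snd_simplex_prod: "\<sigma> \<in> simplices (K \<times>\<^sub>o L) \<Longrightarrow> snd ` \<sigma> \<in> simplices L"
  by (auto simp: prod_complex_def image_image)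

text \<open>The index sequences required in the product are obtained by enumerating the chain
  \<open>S\<close>; afterwards simplices of the product can be recognised by pairwise
  comparability.\<close>

lemma simplices_prodI:
  assumes K: "ordered_complex K" and L: "ordered_complex L"
    and S: "fst ` S \<in> simplices K" "snd ` S \<in> simplices L"
    and chain: "\<forall>x\<in>S. \<forall>y\<in>S. x = y \<or> (x, y) \<in> vorder (K \<times>\<^sub>o L) \<or> (y, x) \<in> vorder (K \<times>\<^sub>o L)"
  shows "S \<in> simplices (K \<times>\<^sub>o L)"
proof -
  have "finite (fst ` S \<times> snd ` S)"
    using S ordered_complex_finite[OF K] ordered_complex_finite[OF L] by blast
  moreover have "S \<subseteq> fst ` S \<times> snd ` S" by force
  ultimately have "finite S" by (rule rev_finite_subset)
  moreover have "S \<noteq> {}" using S(1) ordered_complex_nonempty[OF K] by blast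
  ultimately obtain n and f :: "nat \<Rightarrow> _" where f: "S = f ` {..n}"
      "\<forall>i<n. (f i, f (Suc i)) \<in> vorder (K \<times>\<^sub>o L)"
    using finite_chain_enumeration[OF _ _ vorder_trans[OF ordered_complex_prod[OF K L]] chain] by blast
  have "(fst (f i), fst (f (Suc i))) \<in> vorder K \<and> (snd (f i), snd (f (Suc i))) \<in> vorder L" if "i < n" for i
    using f(2) that by (metis prod.collapse vorder_prod)
  then show ?thesis
    using S unfolding prod_complex_def f(1)
    by (simp add: image_image) (intro exI[of _ n] exI[of _ "\<lambda>i. fst (f i)"] exI[of _ "\<lambda>i. snd (f i)"], simp)
qed

text \<open>For a point \<open>p\<close> of the realization, segments of length \<open>p v\<close>
  are laid end to end in the vertex order of its support; this is where the segment of
  \<open>v\<close> begins.\<close>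

definition cum_lt :: "'a ocomplex \<Rightarrow> ('a \<Rightarrow> real) \<Rightarrow> 'a \<Rightarrow> real" where
  "cum_lt K p v = (\<Sum>u\<in>{u \<in> vertices K. (u, v) \<in> vorder K \<and> u \<noteq> v}. p u)"

definition cum_le :: "'a ocomplex \<Rightarrow> ('a \<Rightarrow> real) \<Rightarrow> 'a \<Rightarrow> real" where
  "cum_le K p v = cum_lt K p v + p v"

text \<open>The coordinate of the point \<open>(p, q)\<close> at the vertex \<open>(v, w)\<close> in the staircase triangulation of the
  product is the length of the overlap of the intervals \<open>[cum_lt K p v, cum_le K p v]\<close> and
  \<open>[cum_lt K q w, cum_le K q w]\<close>. Only its support matters, so a product vanishing together with
  this length is used instead.\<close>

definition prod_weight :: "'a ocomplex \<Rightarrow> ('a \<Rightarrow> real) \<times> ('a \<Rightarrow> real) \<Rightarrow> 'a \<times> 'a \<Rightarrow> real" where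
  "prod_weight K z x = fst z (fst x) * snd z (snd x)
     * max 0 (cum_le K (fst z) (fst x) - cum_lt K (snd z) (snd x))
     * max 0 (cum_le K (snd z) (snd x) - cum_lt K (fst z) (fst x))"

lemma finite_vertices: "finite_complex K \<Longrightarrow> ordered_complex K \<Longrightarrow> finite (vertices K)"
  by (auto simp: finite_complex_def ordered_complex_def vertices_def)

text \<open>By transitivity and antisymmetry, \<open>v\<close> and all its strict predecessors are
  strict predecessors of \<open>v'\<close>. Hence segments of comparable vertices do not
  overlap.\<close>

lemma cum_le_le_cum_lt:
  assumes K: "ordered_complex K" "finite_complex K" and p: "\<And>v. 0 \<le> p v"
    and v: "v \<in> vertices K" "(v, v') \<in> vorder K" "v \<noteq> v'"
  shows "cum_le K p v \<le> cum_lt K p v'"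
proof -
  let ?L = "\<lambda>v. {u \<in> vertices K. (u, v) \<in> vorder K \<and> u \<noteq> v}"
  have fin: "finite (?L v)" for v using finite_vertices[OF K(2,1)] by simp
  have "insert v (?L v) \<subseteq> ?L v'"
    using v transD[OF vorder_trans[OF K(1)]] antisymD[OF vorder_antisym[OF K(1)]] by blast
  then have "sum p (insert v (?L v)) \<le> sum p (?L v')"
    using fin p by (intro sum_mono2) auto
  moreover have "sum p (insert v (?L v)) = p v + sum p (?L v)"
    using fin by (subst sum.insert) auto
  ultimately show ?thesis by (simp add: cum_le_def cum_lt_def)
qed

text \<open>Positive weight at \<open>(v, w)\<close> means that the segments of \<open>v\<close> and
  \<open>w\<close> overlap. If \<open>v\<close> came before \<open>v'\<close> but \<open>w'\<close>
  before \<open>w\<close>, then \<open>v\<close> with \<open>w\<close> and \<open>v'\<close> with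
  \<open>w'\<close> could not both overlap; so the support is a chain, a staircase.\<close>

lemma support_prod_weight:
  assumes K: "ordered_complex K" "finite_complex K" and z: "z \<in> realization_points K \<times> realization_points K"
  shows "prod_weight K z x \<ge> 0"
    and "support (prod_weight K z) \<subseteq> support (fst z) \<times> support (snd z)"
    and "support (prod_weight K z) \<in> simplices (K \<times>\<^sub>o K)"
proof -
  define p q where "p = fst z" and "q = snd z"
  have pq: "p \<in> realization_points K" "q \<in> realization_points K"
    using z by (auto simp: p_def q_def)
  have p0: "0 \<le> p v" and q0: "0 \<le> q v" for v
    using pq by (meson realization_pointsE closed_simplex_nonneg)+
  show "prod_weight K z x \<ge> 0" for x
    using p0 q0 by (simp add: prod_weight_def p_def q_def)
  show sub: "support (prod_weight K z) \<subseteq> support (fst z) \<times> support (snd z)"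
    by (auto simp: prod_weight_def support_def)
  have pos: "cum_le K p v > cum_lt K q w \<and> cum_le K q w > cum_lt K p v"
    if "(v, w) \<in> support (prod_weight K z)" for v w
    using that by (simp add: prod_weight_def support_def p_def q_def max_def split: if_splits)
  have P: "support p \<in> simplices K" and Q: "support q \<in> simplices K"
    using support_simplex[OF K(1)] pq by blast+
  have Psub: "v \<in> support p \<Longrightarrow> v \<in> vertices K" and Qsub: "v \<in> support q \<Longrightarrow> v \<in> vertices K" for v
    using simplex_subset_vertices[OF P] simplex_subset_vertices[OF Q] by blast+
  \<comment> \<open>The least vertex of a support, found as the maximum for the converse order, has
    its segment starting at 0. The two least vertices therefore form a pair of positive weight, and
    the support of the weights is nonempty.\<close>
  have least: "\<exists>v\<in>support x. cum_lt K x v = 0" if x: "support x \<in> simplices K" for x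
  proof -
    have "\<exists>v\<in>support x. \<forall>u\<in>support x. (u, v) \<in> ((vorder K)\<inverse>)\<^sup>="
      using ordered_complex_finite[OF K(1) x] ordered_complex_nonempty[OF K(1) x] vorder_trans[OF K(1)]
        simplex_total[OF K(1) x]
      by (intro finite_chain_has_maximum) auto
    then obtain v where v: "v \<in> support x" "\<And>u. u \<in> support x \<Longrightarrow> u = v \<or> (v, u) \<in> vorder K"
      by auto
    then have "x u = 0" if "(u, v) \<in> vorder K" "u \<noteq> v" for u
      using that antisymD[OF vorder_antisym[OF K(1)]] unfolding support_def by blast
    then have "cum_lt K x v = 0" by (auto simp: cum_lt_def intro!: sum.neutral)
    then show ?thesis using v(1) by blast
  qed
  obtain v w where vw: "v \<in> support p" "cum_lt K p v = 0" "w \<in> support q" "cum_lt K q w = 0"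
    using least[OF P] least[OF Q] by blast
  then have "p v > 0" "q w > 0"
    using p0 q0 by (auto simp: support_def less_le)
  then have "(v, w) \<in> support (prod_weight K z)"
    using vw by (simp add: support_def prod_weight_def cum_le_def p_def q_def)
  then have ne: "support (prod_weight K z) \<noteq> {}" by blast
  have mono: "(w, w') \<in> vorder K"
    if "(v, w) \<in> support (prod_weight K z)" "(v', w') \<in> support (prod_weight K z)"
      "(v, v') \<in> vorder K" "v \<noteq> v'" for v w v' w'
  proof (rule ccontr)
    assume not: "(w, w') \<notin> vorder K"
    have supp: "v \<in> support p" "w \<in> support q" "v' \<in> support p" "w' \<in> support q"
      using that sub by (auto simp: p_def q_def)
    then have w: "w \<noteq> w'" "(w', w) \<in> vorder K"
      using not simplex_total[OF K(1) Q, of w w'] vorder_refl[OF K(1) Qsub] by blast+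
    have "cum_le K p v \<le> cum_lt K p v'"
      by (rule cum_le_le_cum_lt[OF K p0 Psub that(3,4)]) (rule supp)
    moreover have "cum_le K q w' \<le> cum_lt K q w"
      by (rule cum_le_le_cum_lt[OF K q0 Qsub w(2) w(1)[symmetric]]) (rule supp)
    ultimately show False using pos[OF that(1)] pos[OF that(2)] by linarith
  qed
  show "support (prod_weight K z) \<in> simplices (K \<times>\<^sub>o K)"
  proof (rule simplices_prodI[OF K(1) K(1)])
    have "fst ` support (prod_weight K z) \<subseteq> support p" "snd ` support (prod_weight K z) \<subseteq> support q"
      using sub by (auto simp: p_def q_def)
    then show "fst ` support (prod_weight K z) \<in> simplices K" "snd ` support (prod_weight K z) \<in> simplices K"
      using ordered_complex_face[OF K(1) P] ordered_complex_face[OF K(1) Q] ne by blast+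
    show "\<forall>x\<in>support (prod_weight K z). \<forall>y\<in>support (prod_weight K z).
        x = y \<or> (x, y) \<in> vorder (K \<times>\<^sub>o K) \<or> (y, x) \<in> vorder (K \<times>\<^sub>o K)"
    proof (intro ballI)
      fix x y assume xy: "x \<in> support (prod_weight K z)" "y \<in> support (prod_weight K z)"
      obtain v w v' w' where eq: "x = (v, w)" "y = (v', w')" by (metis surj_pair)
      have supp: "v \<in> support p" "w \<in> support q" "v' \<in> support p" "w' \<in> support q"
        using xy eq sub by (auto simp: p_def q_def)
      show "x = y \<or> (x, y) \<in> vorder (K \<times>\<^sub>o K) \<or> (y, x) \<in> vorder (K \<times>\<^sub>o K)"
        unfolding eq vorder_prod
        using simplex_total[OF K(1) P supp(1,3)] simplex_total[OF K(1) Q supp(2,4)]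
          mono[of v w v' w'] mono[of v' w' v w] vorder_refl[OF K(1) Psub[OF supp(1)]] xy
        unfolding eq by blast
    qed
  qed
qed

lemma continuous_prod_weight:
  assumes K: "ordered_complex K" "finite_complex K"
  shows "continuous_map (prod_topology (geometric_realization K) (geometric_realization K)) euclideanreal
    (\<lambda>z. prod_weight K z x)"
proof -
  let ?XX = "prod_topology (geometric_realization K) (geometric_realization K)"
  have c: "continuous_map ?XX euclideanreal (\<lambda>z. fst z v)" "continuous_map ?XX euclideanreal (\<lambda>z. snd z v)" for v
    using continuous_map_compose[OF continuous_map_fst continuous_map_coordinate[OF K(2)]]
      continuous_map_compose[OF continuous_map_snd continuous_map_coordinate[OF K(2)]]
    by (auto simp: o_def)
  show ?thesis
    unfolding prod_weight_def cum_le_def cum_lt_def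
    using finite_vertices[OF K(2,1)]
    by (intro continuous_map_real_mult continuous_map_real_max continuous_map_diff continuous_map_add
        continuous_map_sum c) auto
qed

section \<open>Finiteness and weights on iterated subdivisions\<close>

lemma finite_complex_sd:
  assumes "finite_complex K"
  shows "finite_complex (sd K)"
proof -
  have "finite (fset -` simplices K)"
    using assms by (intro finite_vimageI) (auto simp: finite_complex_def fset_inject inj_on_def)
  then have "finite (vertices (sd K))"
    unfolding vertices_sd by (simp add: vimage_def setcompr_eq_image)
  moreover have "simplices (sd K) \<subseteq> Pow (vertices (sd K))"
    by (auto simp: vertices_def)
  ultimately show ?thesis
    unfolding finite_complex_def by (meson finite_Pow_iff finite_subset)
qed

lemma finite_complex_Sd: "finite_complex K \<Longrightarrow> finite_complex (Sd b K)"
  by (induction b) (simp_all add: Sd_Suc finite_complex_sd, simp add: Sd_def finite_complex_def vertex_copy_def)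

lemma finite_complex_prod:
  assumes "ordered_complex K" "finite_complex K" "ordered_complex L" "finite_complex L"
  shows "finite_complex (K \<times>\<^sub>o L)"
proof -
  have "simplices (K \<times>\<^sub>o L) \<subseteq> Pow (vertices K \<times> vertices L)"
    by (auto simp: prod_complex_def vertices_def)
  then show ?thesis
    using assms finite_vertices unfolding finite_complex_def by (meson finite_Pow_iff finite_SigmaI finite_subset)
qed

text \<open>A point with coordinates \<open>y\<close> lies in the simplex of the barycentric subdivision given by the
  chain of superlevel sets of \<open>y\<close>; the weights are positive exactly on that chain.\<close>

primrec sd_weight :: "'a ocomplex \<Rightarrow> ('a \<Rightarrow> real) \<Rightarrow> nat \<Rightarrow> 'a sd_vertex \<Rightarrow> real" where
  "sd_weight K x 0 = (\<lambda>z. case z of Vertex v \<Rightarrow> x v | Barycentre F \<Rightarrow> 0)"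
| "sd_weight K x (Suc b) = (\<lambda>z. case z of Vertex v \<Rightarrow> 0 | Barycentre F \<Rightarrow>
     if fset F \<in> simplices (Sd b K)
     then \<Prod>u\<in>fset F. sd_weight K x b u
            * (\<Prod>w\<in>vertices (Sd b K) - fset F. max 0 (sd_weight K x b u - sd_weight K x b w))
     else 0)"

text \<open>A simplex \<open>F\<close> has positive weight iff \<open>y\<close> is positive on
  \<open>F\<close> and larger there than at all other vertices. Two incomparable such sets would
  give \<open>u\<close> and \<open>w\<close> with \<open>y u > y w > y u\<close>. The support of
  \<open>y\<close> is one such set, so the chain is nonempty.\<close>

lemma support_sd_weight:
  assumes K: "ordered_complex K" "finite_complex K"
    and x: "\<And>v. 0 \<le> x v" "support x \<in> simplices K"
  shows "0 \<le> sd_weight K x b z \<and> support (sd_weight K x b) \<in> simplices (Sd b K)"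
proof (induction b arbitrary: z)
  case 0
  have "z \<in> support (sd_weight K x 0) \<longleftrightarrow> z \<in> Vertex ` support x" for z
    by (cases z) (auto simp: support_def)
  then have "support (sd_weight K x 0) = Vertex ` support x" by blast
  then show ?case
    using x by (auto simp: Sd_def vertex_copy_def split: sd_vertex.splits)
next
  case (Suc b)
  define y where "y = sd_weight K x b"
  have y0: "0 \<le> y u" for u
    using Suc by (simp add: y_def)
  have supp: "support y \<in> simplices (Sd b K)"
    using Suc by (simp add: y_def)
  note Sdb = ordered_complex_Sd[OF K(1), of b]
  have V: "finite (vertices (Sd b K))"
    by (intro finite_vertices finite_complex_Sd Sdb K)
  have eq: "sd_weight K x (Suc b) (Barycentre F) = (if fset F \<in> simplices (Sd b K)
     then \<Prod>u\<in>fset F. y u * (\<Prod>w\<in>vertices (Sd b K) - fset F. max 0 (y u - y w)) else 0)" for F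
    by (simp add: y_def)
  have 1: "0 \<le> sd_weight K x (Suc b) z"
    by (cases z) (auto intro!: prod_nonneg mult_nonneg_nonneg y0[unfolded y_def])
  have nonzero: "sd_weight K x (Suc b) (Barycentre F) \<noteq> 0 \<longleftrightarrow> fset F \<in> simplices (Sd b K) \<and>
      (\<forall>u\<in>fset F. y u \<noteq> 0 \<and> (\<forall>w\<in>vertices (Sd b K) - fset F. y w < y u))" for F
  proof -
    have "max 0 (s - t) = 0 \<longleftrightarrow> \<not> t < s" for s t :: real by linarith
    then show ?thesis unfolding eq using V by simp
  qed
  let ?C = "{F. sd_weight K x (Suc b) (Barycentre F) \<noteq> 0}"
  have "z \<in> support (sd_weight K x (Suc b)) \<longleftrightarrow> z \<in> Barycentre ` ?C" for z
    by (cases z) (auto simp: support_def)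
  then have S: "support (sd_weight K x (Suc b)) = Barycentre ` ?C" by blast
  have "Barycentre ` ?C \<in> simplices (sd (Sd b K))"
  proof (rule simplices_sdI)
    have "finite (Barycentre ` ?C)"
    proof (rule finite_subset)
      show "Barycentre ` ?C \<subseteq> vertices (Sd (Suc b) K)"
        unfolding Sd_Suc vertices_sd nonzero by blast
      show "finite (vertices (Sd (Suc b) K))"
        by (intro finite_vertices finite_complex_Sd ordered_complex_Sd K)
    qed
    then show "finite ?C" by (rule finite_imageD) (simp add: inj_on_def)
    obtain F where F: "fset F = support y"
      using ordered_complex_finite[OF Sdb supp] by (metis fset_cases mem_Collect_eq)
    have "F \<in> ?C"
      unfolding mem_Collect_eq nonzero F using supp y0 by (auto simp: support_def less_le)
    then show "?C \<noteq> {}" by blast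
    show "fset F \<in> simplices (Sd b K)" if "F \<in> ?C" for F using that unfolding nonzero by blast
    show "F |\<subseteq>| G \<or> G |\<subseteq>| F" if FG: "F \<in> ?C" "G \<in> ?C" for F G
    proof (rule ccontr)
      assume "\<not> (F |\<subseteq>| G \<or> G |\<subseteq>| F)"
      then obtain u w where uw: "u \<in> fset F" "u \<notin> fset G" "w \<in> fset G" "w \<notin> fset F"
        by (auto simp: less_eq_fset.rep_eq)
      moreover have "u \<in> vertices (Sd b K)" "w \<in> vertices (Sd b K)"
        using uw FG unfolding mem_Collect_eq nonzero vertices_def by blast+
      ultimately have "y w < y u" "y u < y w"
        using FG unfolding mem_Collect_eq nonzero by blast+
      then show False by simp
    qed
  qed
  then show ?case using 1 unfolding S Sd_Suc by blast
qed

text \<open>Positive weight at \<open>Barycentre F\<close> forces positive weight, one stage lower,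
  at every element of \<open>F\<close>, in particular at the one that \<open>\<iota>\<close>
  selects.\<close>

lemma support_sd_weight_base:
  assumes \<iota>: "sd_approximations K \<iota>"
  shows "v \<in> support (sd_weight K x b) \<Longrightarrow> sd_to_base \<iota> b v \<in> support x"
proof (induction b arbitrary: v)
  case 0
  then show ?case by (cases v) (auto simp: support_def)
next
  case (Suc b)
  obtain F where F: "v = Barycentre F" "fset F \<in> simplices (Sd b K)"
    "(\<Prod>u\<in>fset F. sd_weight K x b u
            * (\<Prod>w\<in>vertices (Sd b K) - fset F. max 0 (sd_weight K x b u - sd_weight K x b w))) \<noteq> 0"
    using Suc.prems by (cases v) (auto simp: support_def split: if_splits)
  then have "Barycentre F \<in> vertices (Sd (Suc b) K)"
    unfolding Sd_Suc vertices_sd by blast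
  then have "\<iota> b v \<in> fset F" using \<iota> F(1) by (simp add: sd_approximations_def)
  moreover have "u \<in> support (sd_weight K x b)" if "u \<in> fset F" for u
    using F(3) that by (auto simp: support_def)
  ultimately show ?case using Suc.IH by simp
qed

lemma continuous_sd_weight:
  assumes K: "ordered_complex K" "finite_complex K" and f: "\<And>a. continuous_map T euclideanreal (\<lambda>z. f z a)"
  shows "continuous_map T euclideanreal (\<lambda>z. sd_weight K (f z) b v)"
proof (induction b arbitrary: v)
  case 0
  then show ?case by (cases v) (simp_all add: f)
next
  case (Suc b)
  have V: "finite (vertices (Sd b K))"
    by (intro finite_vertices finite_complex_Sd ordered_complex_Sd K)
  show ?case
  proof (cases v)
    case (Barycentre F)
    have "continuous_map T euclideanreal (\<lambda>z. \<Prod>u\<in>fset F. sd_weight K (f z) b u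
            * (\<Prod>w\<in>vertices (Sd b K) - fset F. max 0 (sd_weight K (f z) b u - sd_weight K (f z) b w)))"
      using V by (intro continuous_map_prod continuous_map_real_mult continuous_map_real_max continuous_map_diff Suc) auto
    then show ?thesis by (simp add: Barycentre)
  qed simp
qed

section \<open>From contiguity to motion planners\<close>

text \<open>The affine extension of the vertex map \<open>H\<close> in barycentric coordinates; for
  probability weights it is the image measure.\<close>

definition push_forward :: "'b set \<Rightarrow> ('b \<Rightarrow> 'a) \<Rightarrow> ('b \<Rightarrow> real) \<Rightarrow> 'a \<Rightarrow> real" where
  "push_forward V H x a = (\<Sum>v\<in>{v \<in> V. H v = a}. x v)"

lemma push_forward_closed_simplex:
  assumes V: "finite V" "\<tau> \<subseteq> V" and x: "x \<in> closed_simplex \<tau>"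
  shows "push_forward V H x \<in> closed_simplex (H ` \<tau>)"
proof -
  have fin: "finite \<tau>" using V finite_subset by blast
  have out: "x v = 0" if "v \<notin> \<tau>" for v using x that by (simp add: closed_simplex_def)
  have eq: "push_forward V H x a = (\<Sum>v\<in>{v \<in> \<tau>. H v = a}. x v)" for a
    unfolding push_forward_def using V out by (intro sum.mono_neutral_right) auto
  have "(\<Sum>a\<in>H ` \<tau>. push_forward V H x a) = sum x \<tau>"
    unfolding eq using fin by (rule sum.image_gen[symmetric])
  moreover have "push_forward V H x a = 0" if "a \<notin> H ` \<tau>" for a
    unfolding eq by (rule sum.neutral) (use that in blast)
  moreover have "0 \<le> push_forward V H x a" for a
    unfolding eq by (intro sum_nonneg closed_simplex_nonneg[OF x])
  ultimately show ?thesis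
    using sum_closed_simplex[OF x] by (simp add: closed_simplex_def)
qed

lemma support_normalised:
  assumes V: "finite V" and y: "\<And>v. 0 \<le> y v" and s: "0 < sum y V"
  shows "(\<lambda>v. if v \<in> V then y v / sum y V else 0) \<in> closed_simplex (support y \<inter> V)"
proof -
  have "sum y (support y \<inter> V) = sum y V"
    using V by (intro sum.mono_neutral_left) (auto simp: support_def)
  then have "(\<Sum>v\<in>support y \<inter> V. if v \<in> V then y v / sum y V else 0) = 1"
    using s by (simp add: sum_divide_distrib[symmetric])
  then show ?thesis
    using y s unfolding closed_simplex_def by (auto simp: support_def)
qed

text \<open>Pushing a point of a simplex \<open>\<sigma>\<close> forward along consecutive maps of
  the chain gives two points of the simplex \<open>H i\<close> \<sigma> \<union> H (Suc i)
  \<open>\<sigma>\<close>, so they are joined linearly.\<close>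

lemma homotopic_push_forward:
  assumes L: "finite_complex L"
    and J: "finite_complex J" "ordered_complex J" and c: "c_contiguous c J L \<phi> \<psi>"
    and r: "\<And>v. continuous_map T euclideanreal (\<lambda>z. r z v)"
      "\<And>z. z \<in> topspace T \<Longrightarrow> r z \<in> realization_points J"
  shows "homotopic_with (\<lambda>_. True) T (geometric_realization L)
    (\<lambda>z. push_forward (vertices J) \<phi> (r z)) (\<lambda>z. push_forward (vertices J) \<psi> (r z))"
proof -
  let ?G = "\<lambda>H z. push_forward (vertices J) H (r z)"
  have V: "finite (vertices J)" using J by (intro finite_vertices)
  obtain H where H: "\<forall>i\<le>c. simplicial_map J L (H i)" "\<forall>v\<in>vertices J. H 0 v = \<phi> v"
    "\<forall>v\<in>vertices J. H c v = \<psi> v" "\<forall>i\<in>{1..c}. contiguous J L (H (i - 1)) (H i)"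
    using c unfolding c_contiguous_def by blast
  \<comment> \<open>The chain agrees with the given maps only on vertices of \<open>J\<close>, and
    those are all that \<open>push_forward\<close> reads.\<close>
  have ends: "?G \<phi> = ?G (H 0)" "?G \<psi> = ?G (H c)"
    using H(2,3) unfolding push_forward_def by (intro ext sum.cong; auto)+
  have supp: "support (r z) \<in> simplices J" "support (r z) \<subseteq> vertices J" "r z \<in> closed_simplex (support (r z))"
    if "z \<in> topspace T" for z
    using support_simplex[OF J(2) r(2)[OF that]] realization_points_in_support[OF J(2) r(2)[OF that]]
    by (auto simp: vertices_def)
  have cont: "continuous_map T (geometric_realization L) (?G (H i))" if "i \<le> c" for i
    unfolding continuous_map_realization_iff[OF L]
  proof (intro conjI allI)
    show "continuous_map T euclideanreal (\<lambda>z. ?G (H i) z a)" for a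
      unfolding push_forward_def using V by (intro continuous_map_sum r) auto
    show "?G (H i) \<in> topspace T \<rightarrow> realization_points L"
    proof
      fix z assume z: "z \<in> topspace T"
      have "H i ` support (r z) \<in> simplices L"
        using H(1) that supp(1)[OF z] by (simp add: simplicial_map_def)
      then show "?G (H i) z \<in> realization_points L"
        using push_forward_closed_simplex[OF V supp(2)[OF z] supp(3)[OF z], of "H i"]
        by (auto simp: realization_points_def)
    qed
  qed
  have "homotopic_with (\<lambda>_. True) T (geometric_realization L) (?G (H 0)) (?G (H i))" if "i \<le> c" for i
    using that
  proof (induction i)
    case (Suc i)
    have "homotopic_with (\<lambda>_. True) T (geometric_realization L) (?G (H i)) (?G (H (Suc i)))"
    proof (rule homotopic_linear[OF L cont cont])
      fix z assume z: "z \<in> topspace T"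
      let ?\<sigma> = "H i ` support (r z) \<union> H (Suc i) ` support (r z)"
      have "contiguous J L (H i) (H (Suc i))"
        using H(4) Suc.prems by (auto dest: bspec[of _ _ "Suc i"])
      then have "?\<sigma> \<in> simplices L"
        using supp(1)[OF z] by (simp add: contiguous_def)
      moreover have "finite ?\<sigma>"
        using finite_subset[OF supp(2)[OF z] V] by simp
      then have "?G (H i) z \<in> closed_simplex ?\<sigma>" "?G (H (Suc i)) z \<in> closed_simplex ?\<sigma>"
        using push_forward_closed_simplex[OF V supp(2)[OF z] supp(3)[OF z]] closed_simplex_mono[of _ ?\<sigma>] by blast+
      ultimately show "\<exists>\<sigma>\<in>simplices L. ?G (H i) z \<in> closed_simplex \<sigma> \<and> ?G (H (Suc i)) z \<in> closed_simplex \<sigma>"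
        by blast
    qed (use Suc.prems in auto)
    then show ?case using Suc by (blast intro: homotopic_with_trans Suc_leD)
  qed (simp add: cont)
  then show ?thesis unfolding ends by simp
qed

text \<open>On \<open>U i\<close> the first projection is linearly homotopic to \<open>?F\<close>,
  contiguity joins \<open>?F\<close> to \<open>?G\<close>, and \<open>?G\<close> is linearly
  homotopic to the second projection.\<close>

lemma motion_planners_from_contiguity:
  assumes K: "ordered_complex K" "finite_complex K"
    and \<iota>: "sd_approximations (K \<times>\<^sub>o K) \<iota>"
    and cover: "contiguity_cover (K \<times>\<^sub>o K) K \<iota> fst snd b c k J"
  shows "\<exists>U. (\<forall>i\<le>k. openin (prod_topology (geometric_realization K) (geometric_realization K)) (U i)) \<and>
    (\<Union>i\<le>k. U i) = topspace (prod_topology (geometric_realization K) (geometric_realization K)) \<and>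
    (\<forall>i\<le>k. has_motion_planner (geometric_realization K) (U i))"
proof -
  let ?X = "geometric_realization K" and ?KK = "K \<times>\<^sub>o K"
  let ?XX = "prod_topology ?X ?X"
  \<comment> \<open>The extra subdivision makes the subcomplexes full, so the weights restricted to
    \<open>J' i\<close> are supported on a simplex of \<open>J' i\<close>.\<close>
  define J' where "J' i = sd (J i)" for i
  define \<beta> where "\<beta> = sd_to_base \<iota> (Suc b)"
  define y where "y z = sd_weight ?KK (prod_weight K z) (Suc b)" for z
  define s where "s i z = sum (y z) (vertices (J' i))" for i z
  define U where "U i = {z \<in> topspace ?XX. s i z \<in> {0<..}}" for i
  have KK: "ordered_complex ?KK" "finite_complex ?KK"
    using ordered_complex_prod[OF K(1) K(1)] finite_complex_prod[OF K K] by auto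
  have J': "contiguity_cover ?KK K \<iota> fst snd (Suc b) c k J'"
    unfolding J'_def by (rule contiguity_cover_sd[OF \<iota> cover])
  have J'sub: "simplices (J' i) \<subseteq> simplices (Sd (Suc b) ?KK)" "ordered_complex (J' i)" if "i \<le> k" for i
    using J' that by (simp_all add: contiguity_cover_def subcomplex_def)
  have J'fin: "finite_complex (J' i)" if "i \<le> k" for i
    using J'sub(1)[OF that] finite_complex_Sd[OF KK(2), of "Suc b"] unfolding finite_complex_def
    by (rule finite_subset)
  have V: "finite (vertices (J' i))" if "i \<le> k" for i
    by (rule finite_vertices[OF J'fin[OF that] J'sub(2)[OF that]])
  have ycont: "continuous_map ?XX euclideanreal (\<lambda>z. y z v)" for v
    unfolding y_def by (intro continuous_sd_weight KK continuous_prod_weight K)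
  have scont: "continuous_map ?XX euclideanreal (s i)" if "i \<le> k" for i
    unfolding s_def using V[OF that] by (intro continuous_map_sum ycont)
  have y: "0 \<le> y z v" "support (y z) \<in> simplices (Sd (Suc b) ?KK)"
    "\<beta> ` support (y z) \<subseteq> support (fst z) \<times> support (snd z)"
    if z: "z \<in> topspace ?XX" for z v
  proof -
    have z': "z \<in> realization_points K \<times> realization_points K" using z by simp
    note w = support_prod_weight[OF K z']
    show "0 \<le> y z v" "support (y z) \<in> simplices (Sd (Suc b) ?KK)"
      unfolding y_def using support_sd_weight[OF KK w(1,3)] by blast+
    show "\<beta> ` support (y z) \<subseteq> support (fst z) \<times> support (snd z)"
      unfolding y_def \<beta>_def using support_sd_weight_base[OF \<iota>] w(2) by blast
  qed
  have open_U: "openin ?XX (U i)" if "i \<le> k" for i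
    unfolding U_def by (rule openin_continuous_map_preimage[OF scont[OF that]]) simp
  \<comment> \<open>The support of \<open>y z\<close> is a simplex, hence lies in some
    \<open>J' i\<close>, and its total weight there is positive.\<close>
  have "z \<in> (\<Union>i\<le>k. U i)" if z: "z \<in> topspace ?XX" for z
  proof -
    obtain i where i: "i \<le> k" "support (y z) \<in> simplices (J' i)"
      using y(2)[OF z] J' unfolding contiguity_cover_def covers_def by blast
    obtain v where v: "v \<in> support (y z)"
      using ordered_complex_nonempty[OF J'sub(2)[OF i(1)] i(2)] by blast
    have vJ: "v \<in> vertices (J' i)" using v i(2) unfolding vertices_def by blast
    have "0 < y z v" using v y(1)[OF z, of v] by (simp add: support_def less_le)
    then have "0 < s i z"
      unfolding s_def using y(1)[OF z] by (intro sum_pos2[OF V[OF i(1)] vJ])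
    then show ?thesis using z i(1) by (auto simp: U_def)
  qed
  then have cover_U: "(\<Union>i\<le>k. U i) = topspace ?XX" by (auto simp: U_def)
  have "has_motion_planner ?X (U i)" if i: "i \<le> k" for i
  proof -
    let ?T = "subtopology ?XX (U i)"
    define r where "r z v = (if v \<in> vertices (J' i) then y z v / s i z else 0)" for z v
    have T: "topspace ?T = U i" by (auto simp: U_def)
    have rsimp: "support (y z) \<inter> vertices (J' i) \<in> simplices (J' i)"
      "r z \<in> closed_simplex (support (y z) \<inter> vertices (J' i))" if "z \<in> topspace ?T" for z
    proof -
      have z: "z \<in> topspace ?XX" "0 < s i z" using that by (auto simp: U_def)
      show r: "r z \<in> closed_simplex (support (y z) \<inter> vertices (J' i))"
        unfolding r_def s_def
        using support_normalised[OF V[OF i] y(1)[OF z(1)] z(2)[unfolded s_def]] .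
      have "support (y z) \<inter> vertices (J' i) \<noteq> {}"
        using sum_closed_simplex[OF r] by (metis sum.empty zero_neq_one)
      then show "support (y z) \<inter> vertices (J' i) \<in> simplices (J' i)"
        unfolding J'_def by (rule sd_subcomplex_full[OF y(2)[OF z(1), unfolded Sd_Suc] Int_lower1 _ Int_lower2])
    qed
    have rcont: "continuous_map ?T euclideanreal (\<lambda>z. r z v)" for v
    proof -
      have "continuous_map ?T euclideanreal (\<lambda>z. y z v / s i z)"
        by (intro continuous_map_real_divide continuous_map_from_subtopology ycont scont i)
          (simp add: U_def)
      then show ?thesis unfolding r_def by simp
    qed
    have rpts: "r z \<in> realization_points (J' i)" if "z \<in> topspace ?T" for z
      using rsimp[OF that] by (auto simp: realization_points_def)
    let ?F = "\<lambda>z. push_forward (vertices (J' i)) (fst \<circ> \<beta>) (r z)"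
    let ?G = "\<lambda>z. push_forward (vertices (J' i)) (snd \<circ> \<beta>) (r z)"
    have "c_contiguous c (J' i) K (fst \<circ> \<beta>) (snd \<circ> \<beta>)"
      using J' i by (simp add: contiguity_cover_def \<beta>_def)
    then have FG: "homotopic_with (\<lambda>_. True) ?T ?X ?F ?G"
      by (intro homotopic_push_forward K J'fin J'sub i rcont rpts)
    \<comment> \<open>Used twice, with \<open>fst \<circ> \<beta>\<close> and
      \<open>snd \<circ> \<beta>\<close> as \<open>f\<close>: the pushed point lies in the simplex
      carrying the coordinate \<open>p\<close> of \<open>z\<close>, as the linear homotopies
      require.\<close>
    have near: "push_forward (vertices (J' i)) f (r z) \<in> closed_simplex (support p)"
      if z: "z \<in> topspace ?T" and p: "p \<in> realization_points K" "f ` support (y z) \<subseteq> support p" for z f p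
    proof -
      have "f ` (support (y z) \<inter> vertices (J' i)) \<subseteq> support p" using p(2) by blast
      then show ?thesis
        using push_forward_closed_simplex[OF V[OF i] Int_lower2 rsimp(2)[OF z], of f]
          closed_simplex_mono[OF _ ordered_complex_finite[OF K(1) support_simplex[OF K(1) p(1)]]]
        by blast
    qed
    have cf: "continuous_map ?T ?X fst" "continuous_map ?T ?X snd"
      by (simp_all add: continuous_map_fst continuous_map_snd continuous_map_from_subtopology)
    have "homotopic_with (\<lambda>_. True) ?T ?X fst ?F"
    proof (rule homotopic_linear[OF K(2) cf(1)])
      show "continuous_map ?T ?X ?F" using homotopic_with_imp_continuous_maps[OF FG] by blast
      fix z assume z: "z \<in> topspace ?T"
      then have p: "fst z \<in> realization_points K" and z': "z \<in> topspace ?XX" by auto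
      have "?F z \<in> closed_simplex (support (fst z))"
        using y(3)[OF z'] by (intro near[OF z p]) auto
      then show "\<exists>\<sigma>\<in>simplices K. fst z \<in> closed_simplex \<sigma> \<and> ?F z \<in> closed_simplex \<sigma>"
        using support_simplex[OF K(1) p] realization_points_in_support[OF K(1) p] by blast
    qed
    moreover have "homotopic_with (\<lambda>_. True) ?T ?X snd ?G"
    proof (rule homotopic_linear[OF K(2) cf(2)])
      show "continuous_map ?T ?X ?G" using homotopic_with_imp_continuous_maps[OF FG] by blast
      fix z assume z: "z \<in> topspace ?T"
      then have p: "snd z \<in> realization_points K" and z': "z \<in> topspace ?XX" by auto
      have "?G z \<in> closed_simplex (support (snd z))"
        using y(3)[OF z'] by (intro near[OF z p]) auto
      then show "\<exists>\<sigma>\<in>simplices K. snd z \<in> closed_simplex \<sigma> \<and> ?G z \<in> closed_simplex \<sigma>"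
        using support_simplex[OF K(1) p] realization_points_in_support[OF K(1) p] by blast
    qed
    ultimately have "homotopic_with (\<lambda>_. True) ?T ?X fst snd"
      using FG by (meson homotopic_with_trans homotopic_with_symD)
    then show ?thesis
      using has_motion_planner_iff_homotopic[of "U i" ?X] by (auto simp: U_def)
  qed
  then show ?thesis using open_U cover_U by blast
qed

section \<open>The mesh of the iterated subdivision\<close>

text \<open>The position in the realization of \<open>K\<close> of a vertex of the
  \<open>b\<close>-th subdivision. The value 0 at \<open>Vertex v\<close> in later stages is a
  dummy, since no such vertex occurs there.\<close>

primrec sd_point :: "nat \<Rightarrow> 'a sd_vertex \<Rightarrow> 'a \<Rightarrow> real" where
  "sd_point 0 z = (\<lambda>a. if z = Vertex a then 1 else 0)"
| "sd_point (Suc b) z = (case z of Vertex v \<Rightarrow> (\<lambda>a. 0) | Barycentre F \<Rightarrow>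
     (\<lambda>a. (\<Sum>u\<in>fset F. sd_point b u a) / real (card (fset F))))"

lemma sd_point_nonneg: "0 \<le> sd_point b z a"
  by (induction b arbitrary: z) (auto split: sd_vertex.splits intro!: divide_nonneg_nonneg sum_nonneg)

text \<open>The coordinates are nonnegative, so nothing cancels in the average.\<close>

lemma support_sd_point_Barycentre:
  assumes "fset F \<noteq> {}"
  shows "support (sd_point (Suc b) (Barycentre F)) = (\<Union>u\<in>fset F. support (sd_point b u))"
proof -
  have "(\<Sum>u\<in>fset F. sd_point b u a) = 0 \<longleftrightarrow> (\<forall>u\<in>fset F. sd_point b u a = 0)" for a
    by (intro sum_nonneg_eq_0_iff) (auto simp: sd_point_nonneg)
  moreover have "real (card (fset F)) \<noteq> 0" using assms by simp
  ultimately show ?thesis by (auto simp: support_def)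
qed

lemma average_closed_simplex:
  assumes "finite F" "F \<noteq> {}" "\<And>u. u \<in> F \<Longrightarrow> x u \<in> closed_simplex \<sigma>"
  shows "(\<lambda>a. (\<Sum>u\<in>F. x u a) / real (card F)) \<in> closed_simplex \<sigma>"
proof -
  have "(\<Sum>a\<in>\<sigma>. \<Sum>u\<in>F. x u a) = (\<Sum>u\<in>F. \<Sum>a\<in>\<sigma>. x u a)" by (rule sum.swap)
  also have "\<dots> = real (card F)" using assms(3) by (simp add: sum_closed_simplex)
  finally have "(\<Sum>a\<in>\<sigma>. (\<Sum>u\<in>F. x u a) / real (card F)) = 1"
    using assms(1,2) by (simp add: sum_divide_distrib[symmetric])
  moreover have "0 \<le> x u a" if "u \<in> F" for u a
    using assms(3)[OF that] by (rule closed_simplex_nonneg)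
  moreover have "x u a = 0" if "u \<in> F" "a \<notin> \<sigma>" for u a
    using assms(3)[OF that(1)] that(2) by (simp add: closed_simplex_def)
  ultimately show ?thesis
    unfolding closed_simplex_def by (auto intro!: divide_nonneg_nonneg sum_nonneg)
qed

text \<open>The supports grow along a chain, so their union is the support at the greatest element
  \<open>M\<close>; this is the union over the simplex \<open>fset M\<close> one stage
  lower.\<close>

lemma support_sd_point_simplex:
  assumes K: "ordered_complex K"
  shows "\<sigma> \<in> simplices (Sd b K) \<Longrightarrow> (\<Union>v\<in>\<sigma>. support (sd_point b v)) \<in> simplices K"
proof (induction b arbitrary: \<sigma>)
  case 0
  then obtain \<rho> where \<rho>: "\<rho> \<in> simplices K" "\<sigma> = Vertex ` \<rho>" by (auto simp: Sd_def vertex_copy_def)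
  then have "(\<Union>v\<in>\<sigma>. support (sd_point 0 v)) = \<rho>" by (auto simp: support_def)
  with \<rho> show ?case by simp
next
  case (Suc b)
  from Suc.prems obtain C M where C: "\<sigma> = Barycentre ` C" "finite C" "\<forall>F\<in>C. fset F \<in> simplices (Sd b K)"
    "\<forall>F\<in>C. \<forall>G\<in>C. F |\<subseteq>| G \<or> G |\<subseteq>| F" "M \<in> C" "\<forall>F\<in>C. F |\<subseteq>| M"
    unfolding Sd_Suc by (rule simplices_sdE)
  have S: "support (sd_point (Suc b) (Barycentre F)) = (\<Union>u\<in>fset F. support (sd_point b u))" if "F \<in> C" for F
    using C(3) that ordered_complex_nonempty[OF ordered_complex_Sd[OF K]]
    by (intro support_sd_point_Barycentre) blast
  have "support (sd_point (Suc b) (Barycentre F)) \<subseteq> support (sd_point (Suc b) (Barycentre M))" if "F \<in> C" for F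
    unfolding S[OF that] S[OF C(5)] using C(6) that by (intro UN_mono) (auto simp: less_eq_fset.rep_eq)
  then have "(\<Union>v\<in>\<sigma>. support (sd_point (Suc b) v)) = support (sd_point (Suc b) (Barycentre M))"
    unfolding C(1) using C(5) by blast
  also have "\<dots> = (\<Union>u\<in>fset M. support (sd_point b u))" by (rule S[OF C(5)])
  finally show ?case using Suc.IH[of "fset M"] C(3,5) by simp
qed

lemma sd_point_realization_points:
  assumes K: "ordered_complex K"
  shows "v \<in> vertices (Sd b K) \<Longrightarrow> sd_point b v \<in> realization_points K"
proof (induction b arbitrary: v)
  case 0
  then obtain a where a: "v = Vertex a" "a \<in> vertices K"
    by (auto simp: Sd_def vertex_copy_def vertices_def)
  then have "sd_point 0 v \<in> closed_simplex {a}" by (auto simp: closed_simplex_def)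
  then show ?case using singleton_simplex[OF K a(2)] unfolding realization_points_def by blast
next
  case (Suc b)
  then obtain F where F: "v = Barycentre F" "fset F \<in> simplices (Sd b K)"
    unfolding Sd_Suc vertices_sd by blast
  let ?U = "\<Union>u\<in>fset F. support (sd_point b u)"
  have U: "?U \<in> simplices K" using support_sd_point_simplex[OF K F(2)] .
  have "sd_point b u \<in> closed_simplex ?U" if "u \<in> fset F" for u
  proof -
    have "u \<in> vertices (Sd b K)" using F(2) that unfolding vertices_def by blast
    then have "sd_point b u \<in> closed_simplex (support (sd_point b u))"
      by (intro realization_points_in_support[OF K] Suc.IH)
    moreover have "support (sd_point b u) \<subseteq> ?U" using that by blast
    ultimately show ?thesis using closed_simplex_mono ordered_complex_finite[OF K U] by blast
  qed
  then have "sd_point (Suc b) v \<in> closed_simplex ?U"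
    using average_closed_simplex[of "fset F" "sd_point b" ?U]
      ordered_complex_nonempty[OF ordered_complex_Sd[OF K] F(2)] F(1) by simp
  then show ?case using U unfolding realization_points_def by blast
qed

lemma sd_to_base_in_support:
  assumes K: "ordered_complex K" and \<iota>: "sd_approximations K \<iota>"
  shows "v \<in> vertices (Sd b K) \<Longrightarrow> sd_to_base \<iota> b v \<in> support (sd_point b v)"
proof (induction b arbitrary: v)
  case 0
  then show ?case by (auto simp: Sd_def vertex_copy_def vertices_def support_def)
next
  case (Suc b)
  then obtain F where F: "v = Barycentre F" "fset F \<in> simplices (Sd b K)"
    unfolding Sd_Suc vertices_sd by blast
  have u: "\<iota> b v \<in> fset F"
    using \<iota> Suc.prems unfolding sd_approximations_def F(1) by blast
  then have "\<iota> b v \<in> vertices (Sd b K)" using F(2) unfolding vertices_def by blast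
  then have "sd_to_base \<iota> b (\<iota> b v) \<in> support (sd_point b (\<iota> b v))" by (rule Suc.IH)
  then show ?case
    using support_sd_point_Barycentre[of F b] u F(1) by auto
qed

text \<open>The greatest element of the chain has the largest support. For the unsubdivided complex
  this fails at an edge, where each vertex supports only itself; hence the level
  \<open>Suc b\<close> here and in the argument from motion planners.\<close>

lemma sd_simplex_top_vertex:
  assumes K: "ordered_complex K" and \<iota>: "sd_approximations K \<iota>" and \<sigma>: "\<sigma> \<in> simplices (Sd (Suc b) K)"
  shows "\<exists>w\<in>\<sigma>. sd_to_base \<iota> (Suc b) ` \<sigma> \<subseteq> support (sd_point (Suc b) w)"
proof -
  obtain C M where C: "\<sigma> = Barycentre ` C" "finite C" "\<forall>F\<in>C. fset F \<in> simplices (Sd b K)"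
    "\<forall>F\<in>C. \<forall>G\<in>C. F |\<subseteq>| G \<or> G |\<subseteq>| F" "M \<in> C" "\<forall>F\<in>C. F |\<subseteq>| M"
    using \<sigma> unfolding Sd_Suc by (rule simplices_sdE)
  have S: "support (sd_point (Suc b) (Barycentre F)) = (\<Union>u\<in>fset F. support (sd_point b u))" if "F \<in> C" for F
    using C(3) that ordered_complex_nonempty[OF ordered_complex_Sd[OF K]]
    by (intro support_sd_point_Barycentre) blast
  have "sd_to_base \<iota> (Suc b) (Barycentre F) \<in> support (sd_point (Suc b) (Barycentre M))" if F: "F \<in> C" for F
  proof -
    have "Barycentre F \<in> vertices (Sd (Suc b) K)"
      using \<sigma> F unfolding C(1) vertices_def by blast
    then have "sd_to_base \<iota> (Suc b) (Barycentre F) \<in> support (sd_point (Suc b) (Barycentre F))"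
      by (rule sd_to_base_in_support[OF K \<iota>])
    moreover have "support (sd_point (Suc b) (Barycentre F)) \<subseteq> support (sd_point (Suc b) (Barycentre M))"
      unfolding S[OF F] S[OF C(5)] using C(6) F by (intro UN_mono) (auto simp: less_eq_fset.rep_eq)
    ultimately show ?thesis by blast
  qed
  then show ?thesis using C(5) unfolding C(1) by blast
qed

text \<open>Of the \<open>card G\<close> differences averaged, the one between \<open>u\<close> and
  itself vanishes; this produces the factor below 1.\<close>

lemma average_near_member:
  fixes x :: "'a \<Rightarrow> real"
  assumes G: "finite G" "u \<in> G" and d: "\<And>v w. v \<in> G \<Longrightarrow> w \<in> G \<Longrightarrow> \<bar>x v - x w\<bar> \<le> d"
  shows "\<bar>x u - sum x G / real (card G)\<bar> \<le> (1 - 1 / real (card G)) * d"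
proof -
  have n: "card G > 0" using G by (auto simp: card_gt_0_iff)
  have "(\<Sum>w\<in>G. x u - x w) = (\<Sum>w\<in>G - {u}. x u - x w)"
    using G by (intro sum.mono_neutral_right) auto
  then have "\<bar>\<Sum>w\<in>G. x u - x w\<bar> \<le> (\<Sum>w\<in>G - {u}. \<bar>x u - x w\<bar>)" by (simp add: sum_abs)
  also have "\<dots> \<le> real (card (G - {u})) * d"
    using G(2) d by (intro sum_bounded_above) auto
  also have "card (G - {u}) = card G - 1" using G by simp
  finally have *: "\<bar>real (card G) * x u - sum x G\<bar> \<le> (real (card G) - 1) * d"
    using n by (simp add: sum_subtractf of_nat_diff)
  have "\<bar>x u - sum x G / real (card G)\<bar> = \<bar>real (card G) * x u - sum x G\<bar> / real (card G)"
  proof -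
    have "x u - sum x G / real (card G) = (real (card G) * x u - sum x G) / real (card G)"
      using n by (simp add: field_simps)
    then show ?thesis by (simp add: abs_divide)
  qed
  also have "\<dots> \<le> ((real (card G) - 1) * d) / real (card G)"
    using * by (intro divide_right_mono) auto
  also have "\<dots> = (1 - 1 / real (card G)) * d"
    using n by (simp add: field_simps)
  finally show ?thesis .
qed

lemma average_near_average:
  fixes x :: "'a \<Rightarrow> real"
  assumes G: "finite G" "F \<subseteq> G" "F \<noteq> {}" and d: "\<And>v w. v \<in> G \<Longrightarrow> w \<in> G \<Longrightarrow> \<bar>x v - x w\<bar> \<le> d"
  shows "\<bar>sum x F / real (card F) - sum x G / real (card G)\<bar> \<le> (1 - 1 / real (card G)) * d"
proof -
  let ?c = "sum x G / real (card G)" and ?e = "(1 - 1 / real (card G)) * d"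
  have F: "finite F" using G finite_subset by blast
  then have n: "card F > 0" using G(3) by (simp add: card_gt_0_iff)
  have "\<bar>\<Sum>u\<in>F. x u - ?c\<bar> \<le> (\<Sum>u\<in>F. \<bar>x u - ?c\<bar>)" by (rule sum_abs)
  also have "\<dots> \<le> real (card F) * ?e"
    using G(1,2) d by (intro sum_bounded_above average_near_member) auto
  finally have *: "\<bar>sum x F - real (card F) * ?c\<bar> \<le> real (card F) * ?e"
    by (simp add: sum_subtractf)
  have "\<bar>sum x F / real (card F) - ?c\<bar> = \<bar>sum x F - real (card F) * ?c\<bar> / real (card F)"
  proof -
    have "sum x F / real (card F) - ?c = (sum x F - real (card F) * ?c) / real (card F)"
      using n by (simp add: diff_divide_distrib)
    then show ?thesis by (simp only: abs_divide abs_of_nat)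
  qed
  also have "\<dots> \<le> (real (card F) * ?e) / real (card F)"
    using * by (intro divide_right_mono) auto
  also have "\<dots> = ?e" using n by simp
  finally show ?thesis .
qed

text \<open>The members of a chain have distinct cardinalities, and by induction these lie in
  \<open>{1..N}\<close>.\<close>

lemma card_simplex_Sd:
  assumes K: "ordered_complex K" and N: "\<And>\<sigma>. \<sigma> \<in> simplices K \<Longrightarrow> card \<sigma> \<le> N"
  shows "\<sigma> \<in> simplices (Sd b K) \<Longrightarrow> card \<sigma> \<le> N"
proof (induction b arbitrary: \<sigma>)
  case 0
  then show ?case using N by (auto simp: Sd_def vertex_copy_def card_image inj_on_def)
next
  case (Suc b)
  from Suc.prems obtain C M where C: "\<sigma> = Barycentre ` C" "finite C" "\<forall>F\<in>C. fset F \<in> simplices (Sd b K)"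
    "\<forall>F\<in>C. \<forall>G\<in>C. F |\<subseteq>| G \<or> G |\<subseteq>| F" "M \<in> C" "\<forall>F\<in>C. F |\<subseteq>| M"
    unfolding Sd_Suc by (rule simplices_sdE)
  have eq: "F = G" if "F |\<subseteq>| G" "card (fset F) = card (fset G)" for F G :: "'a sd_vertex fset"
    using that card_subset_eq[of "fset G" "fset F"] by (simp add: less_eq_fset.rep_eq fset_inject)
  have "inj_on (\<lambda>F. card (fset F)) C"
  proof (rule inj_onI)
    fix F G assume FG: "F \<in> C" "G \<in> C" "card (fset F) = card (fset G)"
    then have "F |\<subseteq>| G \<or> G |\<subseteq>| F" using C(4) by blast
    then show "F = G" using eq[of F G] eq[of G F] FG(3) by metis
  qed
  moreover have "(\<lambda>F. card (fset F)) ` C \<subseteq> {1..N}"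
  proof
    fix n assume "n \<in> (\<lambda>F. card (fset F)) ` C"
    then obtain F where F: "F \<in> C" "n = card (fset F)" by blast
    have "fset F \<noteq> {}" using C(3) F(1) ordered_complex_nonempty[OF ordered_complex_Sd[OF K]] by blast
    then have "card (fset F) > 0" by (simp add: card_gt_0_iff)
    moreover have "card (fset F) \<le> N" using C(3) F(1) by (intro Suc.IH) blast
    ultimately show "n \<in> {1..N}" using F(2) by simp
  qed
  ultimately have "card C \<le> card {1..N}" by (metis card_inj_on_le finite_atLeastAtMost)
  then show ?case unfolding C(1) by (simp add: card_image inj_on_def)
qed

text \<open>Each subdivision contracts every coordinate difference by \<open>1 - 1 / N\<close>: for
  \<open>F\<close> contained in \<open>G\<close>, both barycentres are averages over subsets of the
  simplex \<open>G\<close>. Initially all coordinates are 0 or 1, which gives the bound 1.\<close>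

lemma sd_mesh:
  assumes K: "ordered_complex K" and N: "\<And>\<sigma>. \<sigma> \<in> simplices K \<Longrightarrow> card \<sigma> \<le> N"
  shows "\<sigma> \<in> simplices (Sd b K) \<Longrightarrow> u \<in> \<sigma> \<Longrightarrow> v \<in> \<sigma> \<Longrightarrow>
    \<bar>sd_point b u a - sd_point b v a\<bar> \<le> (1 - 1 / real N) ^ b"
proof (induction b arbitrary: \<sigma> u v)
  case (Suc b)
  from Suc.prems(1) obtain C M where C: "\<sigma> = Barycentre ` C" "finite C" "\<forall>F\<in>C. fset F \<in> simplices (Sd b K)"
    "\<forall>F\<in>C. \<forall>G\<in>C. F |\<subseteq>| G \<or> G |\<subseteq>| F" "M \<in> C" "\<forall>F\<in>C. F |\<subseteq>| M"
    unfolding Sd_Suc by (rule simplices_sdE)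
  have *: "\<bar>sd_point (Suc b) (Barycentre F) a - sd_point (Suc b) (Barycentre G) a\<bar> \<le> (1 - 1 / real N) ^ Suc b"
    if FG: "F \<in> C" "G \<in> C" "F |\<subseteq>| G" for F G
  proof -
    have s: "fset F \<in> simplices (Sd b K)" "fset G \<in> simplices (Sd b K)" using C(3) FG by auto
    have ne: "fset F \<noteq> {}" "fset G \<noteq> {}"
      using s ordered_complex_nonempty[OF ordered_complex_Sd[OF K]] by blast+
    have n: "0 < card (fset G)" "card (fset G) \<le> N"
      using ne(2) card_simplex_Sd[OF K N s(2)] by (simp_all add: card_gt_0_iff)
    then have r: "0 \<le> 1 - 1 / real N" "1 - 1 / real (card (fset G)) \<le> 1 - 1 / real N"
      by (simp_all add: field_simps)
    have "\<bar>sd_point (Suc b) (Barycentre F) a - sd_point (Suc b) (Barycentre G) a\<bar>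
        \<le> (1 - 1 / real (card (fset G))) * (1 - 1 / real N) ^ b"
      using average_near_average[of "fset G" "fset F" "\<lambda>u. sd_point b u a"] ne FG(3) Suc.IH[OF s(2)]
      by (simp add: less_eq_fset.rep_eq)
    also have "\<dots> \<le> (1 - 1 / real N) * (1 - 1 / real N) ^ b"
      using r by (intro mult_right_mono zero_le_power)
    finally show ?thesis by simp
  qed
  obtain F G where FG: "F \<in> C" "G \<in> C" "u = Barycentre F" "v = Barycentre G"
    using Suc.prems(2,3) C(1) by blast
  then consider "F |\<subseteq>| G" | "G |\<subseteq>| F" using C(4) by blast
  then show ?case
    using *[OF FG(1,2)] *[OF FG(2,1)] FG(3,4) by cases (simp_all only: abs_minus_commute)
qed simp

section \<open>A metric on the realization\<close>

text \<open>The l1 distance of coordinates, introduced so that Lebesgue's lemma for metric spaces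
  becomes applicable.\<close>

definition coord_dist :: "'a ocomplex \<Rightarrow> ('a \<Rightarrow> real) \<Rightarrow> ('a \<Rightarrow> real) \<Rightarrow> real" where
  "coord_dist K p q = (\<Sum>a\<in>vertices K. \<bar>p a - q a\<bar>)"

lemma coord_dist_triangle: "coord_dist K p r \<le> coord_dist K p q + coord_dist K q r"
  unfolding coord_dist_def sum.distrib[symmetric] by (rule sum_mono) linarith

lemma coord_dist_commute: "coord_dist K p q = coord_dist K q p"
  by (simp add: coord_dist_def abs_minus_commute)

lemma realization_points_outside:
  assumes "x \<in> realization_points K" "a \<notin> vertices K"
  shows "x a = 0"
proof -
  obtain \<sigma> where "\<sigma> \<in> simplices K" "x \<in> closed_simplex \<sigma>" using assms(1) by (rule realization_pointsE)
  moreover from this have "a \<notin> \<sigma>" using assms(2) unfolding vertices_def by blast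
  ultimately show ?thesis by (simp add: closed_simplex_def)
qed

lemma coordinate_le_coord_dist:
  assumes K: "ordered_complex K" "finite_complex K"
    and xy: "x \<in> realization_points K" "y \<in> realization_points K"
  shows "\<bar>x a - y a\<bar> \<le> coord_dist K x y"
proof (cases "a \<in> vertices K")
  case True
  then show ?thesis
    unfolding coord_dist_def using finite_vertices[OF K(2,1)]
    by (intro member_le_sum[of a _ "\<lambda>a. \<bar>x a - y a\<bar>"]) auto
next
  case False
  then show ?thesis
    using realization_points_outside[OF xy(1)] realization_points_outside[OF xy(2)]
    by (simp add: coord_dist_def sum_nonneg)
qed

lemma Metric_space_realization:
  assumes K: "ordered_complex K" "finite_complex K"
  shows "Metric_space (realization_points K) (coord_dist K)"
proof
  show "0 \<le> coord_dist K x y" for x y by (simp add: coord_dist_def sum_nonneg)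
  show "coord_dist K x y = 0 \<longleftrightarrow> x = y" if "x \<in> realization_points K" "y \<in> realization_points K" for x y
  proof
    assume "coord_dist K x y = 0"
    then have "\<bar>x a - y a\<bar> \<le> 0" for a using coordinate_le_coord_dist[OF K that] by metis
    then show "x = y" by (intro ext) simp
  qed (simp add: coord_dist_def)
qed (rule coord_dist_commute coord_dist_triangle)+

lemma continuous_coord_dist:
  assumes K: "ordered_complex K" "finite_complex K"
  shows "continuous_map (geometric_realization K) euclideanreal (coord_dist K p)"
  unfolding coord_dist_def using finite_vertices[OF K(2,1)]
  by (intro continuous_map_sum continuous_map_real_abs continuous_map_diff continuous_map_coordinate K) auto

text \<open>Balls are open because the distance is continuous; conversely every coordinate is
  1-Lipschitz, so the identity from the metric topology is continuous.\<close>

lemma mtopology_realization: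
  assumes K: "ordered_complex K" "finite_complex K"
  shows "Metric_space.mtopology (realization_points K) (coord_dist K) = geometric_realization K"
proof -
  interpret Metric_space "realization_points K" "coord_dist K"
    by (rule Metric_space_realization[OF K])
  have ball: "openin (geometric_realization K) (mball x r)" if "x \<in> realization_points K" for x r
  proof -
    have "mball x r = {y \<in> topspace (geometric_realization K). coord_dist K x y \<in> {..<r}}"
      using that by auto
    then show ?thesis
      using openin_continuous_map_preimage[OF continuous_coord_dist[OF K], of "{..<r}" x] by simp
  qed
  have "continuous_map mtopology euclideanreal (\<lambda>x. x a)" for a
    unfolding continuous_map
  proof (intro conjI allI impI)
    fix W :: "real set" assume "openin euclideanreal W"
    then have W: "open W" by simp
    have "\<exists>r>0. mball x r \<subseteq> {x \<in> topspace mtopology. x a \<in> W}"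
      if x: "x \<in> realization_points K" "x a \<in> W" for x
    proof -
      obtain r where r: "r > 0" "\<And>t. dist t (x a) < r \<Longrightarrow> t \<in> W"
        using W x(2) unfolding open_dist by blast
      have "y a \<in> W" if "y \<in> mball x r" for y
        using coordinate_le_coord_dist[OF K x(1), of y a] that
        by (intro r(2)) (auto simp: dist_real_def abs_minus_commute)
      then show ?thesis using r(1) by (intro exI[of _ r]) auto
    qed
    then show "openin mtopology {x \<in> topspace mtopology. x a \<in> W}"
      unfolding openin_mtopology by auto
  qed simp
  then have "continuous_map mtopology (geometric_realization K) (\<lambda>x. x)"
    unfolding continuous_map_realization_iff[OF K(2)] by simp
  then have 1: "openin mtopology S" if "openin (geometric_realization K) S" for S
  proof -
    have "{x \<in> topspace mtopology. x \<in> S} = S"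
      using openin_subset[OF that] by auto
    then show ?thesis
      using openin_continuous_map_preimage[OF \<open>continuous_map mtopology _ (\<lambda>x. x)\<close> that] by simp
  qed
  have 2: "openin (geometric_realization K) S" if "openin mtopology S" for S
  proof (subst openin_subopen, rule ballI)
    fix x assume x: "x \<in> S"
    note S = conjunct1[OF iffD1[OF openin_mtopology that]] conjunct2[OF iffD1[OF openin_mtopology that]]
    obtain r where r: "r > 0" "mball x r \<subseteq> S" using S(2)[rule_format, OF x] by (elim exE conjE)
    have xM: "x \<in> realization_points K" using S(1) x by (rule subsetD)
    show "\<exists>T. openin (geometric_realization K) T \<and> x \<in> T \<and> T \<subseteq> S"
      using ball[OF xM] r xM by (intro exI[of _ "mball x r"] conjI) simp_all
  qed
  show ?thesis unfolding topology_eq by (intro allI iffI) (erule 2, erule 1)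
qed

lemma compact_space_realization: "finite_complex K \<Longrightarrow> compact_space (geometric_realization K)"
  by (simp add: geometric_realization_eq compact_realization_points compact_space_subtopology)

section \<open>Lebesgue numbers on the product with the time interval\<close>

definition near :: "'a ocomplex \<Rightarrow> real \<Rightarrow> ('a \<Rightarrow> real) \<times> ('a \<Rightarrow> real) \<Rightarrow> ('a \<Rightarrow> real) \<times> ('a \<Rightarrow> real) \<Rightarrow> bool" where
  "near K \<epsilon> z z' \<longleftrightarrow> coord_dist K (fst z) (fst z') < \<epsilon> \<and> coord_dist K (snd z) (snd z') < \<epsilon>"

lemma near_mono: "near K \<epsilon> z z' \<Longrightarrow> \<epsilon> \<le> \<delta> \<Longrightarrow> near K \<delta> z z'"
  by (auto simp: near_def)

lemma near_refl: "0 < \<epsilon> \<Longrightarrow> near K \<epsilon> z z"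
  by (simp add: near_def coord_dist_def)

lemma near_triangle: "near K \<delta> x y \<Longrightarrow> near K \<epsilon> y z \<Longrightarrow> near K (\<delta> + \<epsilon>) x z"
  unfolding near_def using coord_dist_triangle by (smt (verit))

text \<open>The product metric is at most the sum of three component distances, so a third of a
  Lebesgue number for it bounds each component.\<close>

lemma lebesgue_number_realization:
  fixes K defines "XXI \<equiv> prod_topology (prod_topology (geometric_realization K) (geometric_realization K))
    (top_of_set {0..1::real})"
  assumes K: "ordered_complex K" "finite_complex K"
    and S: "compactin XXI S" "S \<subseteq> \<Union>\<C>" and op: "\<And>U. U \<in> \<C> \<Longrightarrow> openin XXI U"
  shows "\<exists>\<epsilon>>0. \<forall>x\<in>S. \<exists>U\<in>\<C>. \<forall>y\<in>topspace XXI.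
    near K \<epsilon> (fst x) (fst y) \<and> \<bar>snd x - snd y\<bar> < \<epsilon> \<longrightarrow> y \<in> U"
proof -
  let ?M = "realization_points K" and ?d = "coord_dist K"
  have m: "Metric_space ?M ?d" by (rule Metric_space_realization[OF K])
  then have Q: "Metric_space12 ?M ?d ?M ?d" by (simp add: Metric_space12_def)
  have I: "Metric_space {0..1::real} dist" using Met_TC.subspace by blast
  have It: "Metric_space.mtopology {0..1::real} dist = top_of_set {0..1}"
  proof -
    interpret Submetric UNIV dist "{0..1::real}" by unfold_locales simp
    show ?thesis using mtopology_submetric by simp
  qed
  have m2: "Metric_space (?M \<times> ?M) (prod_dist ?d ?d)" by (rule Metric_space12.prod_metric[OF Q])
  then have R: "Metric_space12 (?M \<times> ?M) (prod_dist ?d ?d) {0..1::real} dist" using I by (simp add: Metric_space12_def)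
  let ?D = "prod_dist (prod_dist ?d ?d) dist"
  interpret P: Metric_space "(?M \<times> ?M) \<times> {0..1::real}" ?D by (rule Metric_space12.prod_metric[OF R])
  have top: "P.mtopology = XXI"
    using Metric_space12.mtopology_prod_metric[OF R] Metric_space12.mtopology_prod_metric[OF Q]
    by (simp add: XXI_def It mtopology_realization[OF K])
  obtain \<epsilon> where \<epsilon>: "\<epsilon> > 0" "\<And>x. x \<in> S \<Longrightarrow> \<exists>U\<in>\<C>. P.mball x \<epsilon> \<subseteq> U"
    using P.lebesgue_number[of S \<C>] S op unfolding top by blast
  have "y \<in> P.mball x \<epsilon>"
    if x: "x \<in> topspace XXI" and y: "y \<in> topspace XXI"
      and n: "near K (\<epsilon> / 3) (fst x) (fst y)" "\<bar>snd x - snd y\<bar> < \<epsilon> / 3" for x y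
  proof -
    obtain p q t p' q' t' where xy: "x = ((p, q), t)" "y = ((p', q'), t')" by (metis surj_pair)
    have mem: "p \<in> ?M" "q \<in> ?M" "t \<in> {0..1}" "p' \<in> ?M" "q' \<in> ?M" "t' \<in> {0..1}"
      using x y by (auto simp: XXI_def xy)
    have "?D x y \<le> prod_dist ?d ?d (p, q) (p', q') + dist t t'"
      unfolding xy using mem by (intro Metric_space12.prod_metric_le_components[OF R]) auto
    also have "prod_dist ?d ?d (p, q) (p', q') \<le> ?d p p' + ?d q q'"
      using mem by (intro Metric_space12.prod_metric_le_components[OF Q]) auto
    also have "?d p p' + ?d q q' + dist t t' < \<epsilon>"
      using n by (simp add: near_def xy dist_real_def)
    finally show ?thesis using mem by (simp add: xy)
  qed
  then have "\<exists>U\<in>\<C>. \<forall>y\<in>topspace XXI.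
      near K (\<epsilon> / 3) (fst x) (fst y) \<and> \<bar>snd x - snd y\<bar> < \<epsilon> / 3 \<longrightarrow> y \<in> U" if "x \<in> S" for x
    using \<epsilon>(2)[OF that] compactin_subset_topspace[OF S(1)] that by (meson subsetD)
  then show ?thesis
    using \<epsilon>(1) by (intro exI[of _ "\<epsilon> / 3"]) simp
qed

definition full_subcomplex :: "'a ocomplex \<Rightarrow> 'a set \<Rightarrow> 'a ocomplex" where
  "full_subcomplex K P = \<lparr>simplices = {\<sigma> \<in> simplices K. \<sigma> \<subseteq> P},
     vorder = Restr (vorder K) (\<Union>{\<sigma> \<in> simplices K. \<sigma> \<subseteq> P})\<rparr>"

lemma subcomplex_full_subcomplex:
  assumes K: "ordered_complex K"
  shows "subcomplex (full_subcomplex K P) K"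
proof -
  let ?V = "\<Union>{\<sigma> \<in> simplices K. \<sigma> \<subseteq> P}"
  have V: "vertices (full_subcomplex K P) = ?V" by (simp add: vertices_def full_subcomplex_def)
  have "?V \<subseteq> vertices K" unfolding vertices_def by blast
  then have refl: "(v, v) \<in> vorder K" if "v \<in> ?V" for v
    using vorder_refl[OF K] that by blast
  have "partial_order_on ?V (Restr (vorder K) ?V)"
    unfolding partial_order_on_def preorder_on_def refl_on_def
    using refl vorder_trans[OF K] vorder_antisym[OF K]
    by (auto intro: trans_Restr intro!: antisymI dest: antisymD)
  moreover have "total_on \<sigma> (Restr (vorder K) ?V)" if \<sigma>: "\<sigma> \<in> simplices K" "\<sigma> \<subseteq> P" for \<sigma>
  proof (rule total_onI)
    fix u v assume uv: "u \<in> \<sigma>" "v \<in> \<sigma>" "u \<noteq> v"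
    moreover have "u \<in> ?V" "v \<in> ?V" using uv \<sigma> by blast+
    ultimately show "(u, v) \<in> Restr (vorder K) ?V \<or> (v, u) \<in> Restr (vorder K) ?V"
      using simplex_total[OF K \<sigma>(1)] by blast
  qed
  moreover have "\<tau> \<in> simplices K" if "\<sigma> \<in> simplices K" "\<tau> \<subseteq> \<sigma>" "\<tau> \<noteq> {}" for \<sigma> \<tau>
    using ordered_complex_face[OF K that] .
  ultimately have "ordered_complex (full_subcomplex K P)"
    unfolding ordered_complex_def V
    using ordered_complex_finite[OF K] ordered_complex_nonempty[OF K]
    by (simp add: full_subcomplex_def) blast
  then show ?thesis
    unfolding subcomplex_def V by (simp add: full_subcomplex_def subset_iff)
qed

text \<open>Contiguity of neighbours already makes each map simplicial, since its images are faces
  of the unions. As \<open>0 < c\<close>, every index belongs to a pair \<open>j\<close>,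
  \<open>Suc j\<close>.\<close>

lemma c_contiguousI:
  assumes J: "ordered_complex J" and L: "ordered_complex L" and c: "0 < c"
    and ends: "\<And>v. v \<in> vertices J \<Longrightarrow> H 0 v = f v" "\<And>v. v \<in> vertices J \<Longrightarrow> H c v = g v"
    and H: "\<And>i. i < c \<Longrightarrow> contiguous J L (H i) (H (Suc i))"
  shows "c_contiguous c J L f g"
proof -
  have "simplicial_map J L (H i)" if "i \<le> c" for i
    unfolding simplicial_map_def
  proof
    fix \<sigma> assume \<sigma>: "\<sigma> \<in> simplices J"
    have ne: "H i ` \<sigma> \<noteq> {}" using ordered_complex_nonempty[OF J \<sigma>] by simp
    define j where "j = min i (c - 1)"
    have j: "j < c" "i = j \<or> i = Suc j"
      using that c by (auto simp: j_def)
    have "H j ` \<sigma> \<union> H (Suc j) ` \<sigma> \<in> simplices L"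
      using H[OF j(1)] \<sigma> by (simp add: contiguous_def)
    then show "H i ` \<sigma> \<in> simplices L"
      using ordered_complex_face[OF L, of _ "H i ` \<sigma>"] ne j(2) by (metis Un_upper1 Un_upper2)
  qed
  moreover have "contiguous J L (H (i - 1)) (H i)" if "i \<in> {1..c}" for i
  proof -
    have "i - 1 < c" "Suc (i - 1) = i" using that by auto
    then show ?thesis using H[of "i - 1"] by simp
  qed
  ultimately show ?thesis
    unfolding c_contiguous_def using ends by (intro exI[of _ H]) simp
qed

text \<open>The canonical map from the realization of the product complex to the product of the
  realizations, in coordinates.\<close>

definition marginals :: "'a ocomplex \<Rightarrow> ('a \<times> 'a \<Rightarrow> real) \<Rightarrow> ('a \<Rightarrow> real) \<times> ('a \<Rightarrow> real)" where
  "marginals K x = (push_forward (vertices (K \<times>\<^sub>o K)) fst x, push_forward (vertices (K \<times>\<^sub>o K)) snd x)"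

lemma push_forward_support:
  assumes "finite V" "\<And>v. 0 \<le> x v" "support x \<subseteq> V"
  shows "H ` support x \<subseteq> support (push_forward V H x)"
proof
  fix a assume "a \<in> H ` support x"
  then obtain v where v: "v \<in> support x" "a = H v" by blast
  have "0 < push_forward V H x a"
    unfolding push_forward_def
  proof (rule sum_pos2)
    show "v \<in> {v \<in> V. H v = a}" using v assms(3) by blast
    show "0 < x v" using v(1) assms(2)[of v] by (simp add: support_def less_le)
  qed (use assms(1,2) in auto)
  then show "a \<in> support (push_forward V H x)" by (simp add: support_def)
qed

lemma marginals:
  assumes K: "ordered_complex K" "finite_complex K" and x: "x \<in> realization_points (K \<times>\<^sub>o K)"
  shows "marginals K x \<in> realization_points K \<times> realization_points K"
    and "fst ` support x \<subseteq> support (fst (marginals K x))"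
    and "snd ` support x \<subseteq> support (snd (marginals K x))"
proof -
  note KK = ordered_complex_prod[OF K(1) K(1)]
  have V: "finite (vertices (K \<times>\<^sub>o K))"
    by (intro finite_vertices finite_complex_prod KK K)
  note S = support_simplex[OF KK x] realization_points_in_support[OF KK x]
  note sub = simplex_subset_vertices[OF S(1)]
  have "push_forward (vertices (K \<times>\<^sub>o K)) fst x \<in> realization_points K"
    "push_forward (vertices (K \<times>\<^sub>o K)) snd x \<in> realization_points K"
    using push_forward_closed_simplex[OF V sub S(2)] fst_simplex_prod[OF S(1)] snd_simplex_prod[OF S(1)]
    unfolding realization_points_def by blast+
  then show "marginals K x \<in> realization_points K \<times> realization_points K" by (simp add: marginals_def)
  show "fst ` support x \<subseteq> support (fst (marginals K x))" "snd ` support x \<subseteq> support (snd (marginals K x))"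
    using push_forward_support[OF V closed_simplex_nonneg[OF S(2)] sub] by (simp_all add: marginals_def)
qed

lemma coord_dist_push_forward:
  assumes "finite V" and e: "\<And>a. \<bar>x a - y a\<bar> \<le> e"
  shows "coord_dist K (push_forward V H x) (push_forward V H y) \<le> real (card (vertices K)) * (real (card V) * e)"
  unfolding coord_dist_def
proof (rule sum_bounded_above)
  fix a
  let ?W = "{v \<in> V. H v = a}"
  have "\<bar>push_forward V H x a - push_forward V H y a\<bar> \<le> (\<Sum>v\<in>?W. \<bar>x v - y v\<bar>)"
    by (simp add: push_forward_def sum_subtractf[symmetric] sum_abs)
  also have "\<dots> \<le> (\<Sum>v\<in>V. \<bar>x v - y v\<bar>)" using assms(1) by (intro sum_mono2) auto
  also have "\<dots> \<le> real (card V) * e" by (rule sum_bounded_above) (rule e)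
  finally show "\<bar>push_forward V H x a - push_forward V H y a\<bar> \<le> real (card V) * e" .
qed

lemma near_marginals:
  assumes "finite (vertices (K \<times>\<^sub>o K))" "\<And>a. \<bar>x a - y a\<bar> \<le> e"
    and "real (card (vertices K)) * (real (card (vertices (K \<times>\<^sub>o K))) * e) < \<epsilon>"
  shows "near K \<epsilon> (marginals K x) (marginals K y)"
  using order.strict_trans1[OF coord_dist_push_forward[OF assms(1), of x y e] assms(3)] assms(2)
  unfolding near_def marginals_def by simp

section \<open>From motion planners to contiguity\<close>

text \<open>The order of quantifiers matters: \<open>\<epsilon>\<close> and \<open>c\<close> depend
  on \<open>U\<close> and \<open>A\<close> only, so the depth \<open>b\<close> may be chosen
  afterwards to suit all members of a cover at once.\<close>

lemma contiguity_from_motion_planner: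
  fixes K :: "'a ocomplex"
  defines "X \<equiv> geometric_realization K"
  assumes K: "ordered_complex K" "finite_complex K"
    and \<iota>: "sd_approximations (K \<times>\<^sub>o K) \<iota>"
    and U: "openin (prod_topology X X) U" "has_motion_planner X U"
    and A: "compactin (prod_topology X X) A" "A \<subseteq> U"
  shows "\<exists>\<epsilon>>0. \<exists>c. \<forall>b J. subcomplex J (Sd (Suc b) (K \<times>\<^sub>o K)) \<and>
    (\<forall>v\<in>vertices J. marginals K (sd_point (Suc b) v) \<in> A) \<and>
    (\<forall>\<sigma>\<in>simplices J. \<forall>v\<in>\<sigma>. \<forall>w\<in>\<sigma>.
      near K \<epsilon> (marginals K (sd_point (Suc b) v)) (marginals K (sd_point (Suc b) w))) \<longrightarrow>
    c_contiguous c J K (fst \<circ> sd_to_base \<iota> (Suc b)) (snd \<circ> sd_to_base \<iota> (Suc b))"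
proof -
  let ?I = "top_of_set {0..1::real}" and ?XX = "prod_topology X X"
  let ?XXI = "prod_topology ?XX ?I"
  note KK = ordered_complex_prod[OF K(1) K(1)]
  have UXX: "U \<subseteq> topspace ?XX" using U(1) by (rule openin_subset)
  have XX: "topspace ?XX = realization_points K \<times> realization_points K" by (simp add: X_def)
  obtain h where h: "continuous_map (prod_topology ?I (subtopology ?XX U)) X h"
    "\<forall>x. h (0, x) = fst x" "\<forall>x. h (1, x) = snd x"
    using U(2) unfolding has_motion_planner_iff_homotopic[OF UXX] homotopic_with_def by metis
  let ?T = "prod_topology (subtopology ?XX U) ?I"
  have topT: "topspace ?T = U \<times> {0..1}" using UXX by auto
  have T: "?T = subtopology ?XXI (U \<times> {0..1})"
    using prod_topology_subtopology(1)[of ?XX U ?I] by simp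
  have "continuous_map ?T (prod_topology ?I (subtopology ?XX U)) (\<lambda>x. (snd x, fst x))"
    by (intro continuous_map_pairedI continuous_map_snd continuous_map_fst)
  from continuous_map_compose[OF this h(1)]
  have g: "continuous_map ?T X (\<lambda>x. h (snd x, fst x))" by (simp add: o_def)
  have hpts: "h (t, z) \<in> realization_points K" if "z \<in> U" "t \<in> {0..1}" for t z
    using continuous_map_image_subset_topspace[OF g] topT that by (fastforce simp: X_def)
  \<comment> \<open>The preimage of the open star of \<open>a\<close> under the homotopy; it is open
    in the whole product because \<open>U\<close> is open.\<close>
  define W where "W a = {x \<in> topspace ?T. h (snd x, fst x) a \<in> {0<..}}" for a
  have W: "openin ?XXI (W a)" for a
  proof (rule openin_trans_full)
    have "continuous_map ?T euclideanreal (\<lambda>x. h (snd x, fst x) a)"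
      using g unfolding X_def continuous_map_realization_iff[OF K(2)] by (elim conjE allE)
    then show "openin (subtopology ?XXI (U \<times> {0..1})) (W a)"
      unfolding T[symmetric] W_def by (rule openin_continuous_map_preimage) simp
    show "openin ?XXI (U \<times> {0..1})"
      using U(1) by (simp add: openin_prod_Times_iff)
  qed
  have "\<exists>\<epsilon>>0. \<forall>x\<in>A \<times> {0..1}. \<exists>G\<in>W ` vertices K. \<forall>y\<in>topspace ?XXI.
    near K \<epsilon> (fst x) (fst y) \<and> \<bar>snd x - snd y\<bar> < \<epsilon> \<longrightarrow> y \<in> G"
    unfolding X_def
  proof (rule lebesgue_number_realization[OF K])
    show "compactin (prod_topology (prod_topology (geometric_realization K) (geometric_realization K)) ?I) (A \<times> {0..1})"
      using A(1) by (simp add: compactin_Times X_def compactin_subtopology)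
    show "A \<times> {0..1} \<subseteq> \<Union> (W ` vertices K)"
    proof
      fix x :: "(('a \<Rightarrow> real) \<times> ('a \<Rightarrow> real)) \<times> real" assume x: "x \<in> A \<times> {0..1}"
      then have xU: "fst x \<in> U" "snd x \<in> {0..1}" using A(2) by auto
      note p = hpts[OF xU]
      obtain a where a: "a \<in> support (h (snd x, fst x))" using support_nonempty[OF p] by blast
      then have "0 < h (snd x, fst x) a"
        using closed_simplex_nonneg[OF realization_points_in_support[OF K(1) p], of a]
        by (simp add: support_def less_le)
      moreover have "a \<in> vertices K"
        using a simplex_subset_vertices[OF support_simplex[OF K(1) p]] by blast
      ultimately show "x \<in> \<Union> (W ` vertices K)"
        using xU by (intro UN_I[of a]) (simp_all only: W_def topT mem_Collect_eq greaterThan_iff mem_Times_iff simp_thms)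
    qed
    show "openin (prod_topology (prod_topology (geometric_realization K) (geometric_realization K)) ?I) G"
      if "G \<in> W ` vertices K" for G
      using that W unfolding X_def by blast
  qed
  then obtain \<epsilon> where \<epsilon>: "\<epsilon> > 0" "\<And>z t. z \<in> A \<Longrightarrow> t \<in> {0..1} \<Longrightarrow> \<exists>a. \<forall>y\<in>topspace ?XXI.
    near K \<epsilon> z (fst y) \<and> \<bar>t - snd y\<bar> < \<epsilon> \<longrightarrow> y \<in> W a"
    by fastforce
  obtain n where n: "inverse (real (Suc n)) < \<epsilon>" using reals_Archimedean[OF \<epsilon>(1)] by blast
  define N where "N = Suc n"
  have N: "0 < N" "1 / real N < \<epsilon>" using n by (simp_all add: N_def inverse_eq_divide)
  show ?thesis
  proof (rule exI[of _ \<epsilon>], rule conjI[OF \<epsilon>(1)], rule exI[of _ "Suc N"], intro allI impI, elim conjE)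
    fix b J
    define m where "m v = marginals K (sd_point (Suc b) v)" for v :: "('a \<times> 'a) sd_vertex"
    define \<beta> where "\<beta> = sd_to_base \<iota> (Suc b)"
    assume J: "subcomplex J (Sd (Suc b) (K \<times>\<^sub>o K))"
      and "\<forall>v\<in>vertices J. marginals K (sd_point (Suc b) v) \<in> A"
      and "\<forall>\<sigma>\<in>simplices J. \<forall>v\<in>\<sigma>. \<forall>w\<in>\<sigma>.
        near K \<epsilon> (marginals K (sd_point (Suc b) v)) (marginals K (sd_point (Suc b) w))"
    then have mA: "\<And>v. v \<in> vertices J \<Longrightarrow> m v \<in> A"
      and mnear: "\<And>\<sigma> v w. \<sigma> \<in> simplices J \<Longrightarrow> v \<in> \<sigma> \<Longrightarrow> w \<in> \<sigma> \<Longrightarrow> near K \<epsilon> (m v) (m w)"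
      by (simp_all add: m_def)
    have Jo: "ordered_complex J" "simplices J \<subseteq> simplices (Sd (Suc b) (K \<times>\<^sub>o K))"
      using J by (simp_all add: subcomplex_def)
    \<comment> \<open>A vertex whose star contains the homotopy near position \<open>m v\<close> and
      time \<open>j / N\<close>, as supplied by the Lebesgue number.\<close>
    define track where "track j v = (SOME a. \<forall>y\<in>topspace ?XXI.
      near K \<epsilon> (m v) (fst y) \<and> \<bar>real j / real N - snd y\<bar> < \<epsilon> \<longrightarrow> y \<in> W a)" for j v
    have in_J: "m v \<in> U" if "v \<in> vertices J" for v using mA[OF that] A(2) by blast
    have track: "track j ` \<sigma> \<subseteq> support (h (t, m w))"
      if \<sigma>: "\<sigma> \<in> simplices J" and w: "w \<in> \<sigma>" and j: "j \<le> N" and t: "t \<in> {0..1}" "\<bar>real j / real N - t\<bar> < \<epsilon>"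
      for \<sigma> w j t
    proof (rule image_subsetI)
      fix v assume v: "v \<in> \<sigma>"
      have J': "v \<in> vertices J" "w \<in> vertices J" using v w \<sigma> unfolding vertices_def by blast+
      have "real j / real N \<in> {0..1}" using j N(1) by simp
      from someI_ex[OF \<epsilon>(2)[OF mA[OF J'(1)] this]]
      have "\<forall>y\<in>topspace ?XXI. near K \<epsilon> (m v) (fst y) \<and> \<bar>real j / real N - snd y\<bar> < \<epsilon> \<longrightarrow> y \<in> W (track j v)"
        unfolding track_def .
      moreover have "(m w, t) \<in> topspace ?XXI" using in_J[OF J'(2)] UXX t(1) by auto
      ultimately have "(m w, t) \<in> W (track j v)"
        using mnear[OF \<sigma> v w] t(2) by (metis fst_conv snd_conv)
      then show "track j v \<in> support (h (t, m w))" by (simp add: W_def support_def)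
    qed
    have simplex: "S \<union> S' \<in> simplices K"
      if "v \<in> vertices J" "t \<in> {0..1}" "S \<subseteq> support (h (t, m v))" "S' \<subseteq> support (h (t, m v))" "S \<noteq> {}"
      for v t S S'
      using ordered_complex_face[OF K(1) support_simplex[OF K(1) hpts[OF in_J[OF that(1)] that(2)]], of "S \<union> S'"] that(3-5)
      by simp
    \<comment> \<open>At the two ends the test point must be the top vertex of the chain \<open>\<sigma>\<close>: its support contains
      the images of all vertices of \<open>\<sigma>\<close> under \<open>\<beta>\<close>.\<close>
    have top: "\<exists>w\<in>\<sigma>. (fst \<circ> \<beta>) ` \<sigma> \<subseteq> support (h (0, m w)) \<and> (snd \<circ> \<beta>) ` \<sigma> \<subseteq> support (h (1, m w))"
      if \<sigma>: "\<sigma> \<in> simplices J" for \<sigma>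
    proof -
      have \<sigma>': "\<sigma> \<in> simplices (Sd (Suc b) (K \<times>\<^sub>o K))" using Jo(2) \<sigma> by (rule subsetD)
      obtain w where w: "w \<in> \<sigma>" "\<beta> ` \<sigma> \<subseteq> support (sd_point (Suc b) w)"
        using sd_simplex_top_vertex[OF KK \<iota> \<sigma>'] unfolding \<beta>_def by blast
      have "w \<in> vertices (Sd (Suc b) (K \<times>\<^sub>o K))" using simplex_subset_vertices[OF \<sigma>'] w(1) by (rule subsetD)
      note M = marginals[OF K sd_point_realization_points[OF KK this]]
      have "(fst \<circ> \<beta>) ` \<sigma> \<subseteq> support (fst (m w))" "(snd \<circ> \<beta>) ` \<sigma> \<subseteq> support (snd (m w))"
        unfolding m_def image_comp[symmetric]
        by (rule order_trans[OF image_mono[OF w(2)] M(2)], rule order_trans[OF image_mono[OF w(2)] M(3)])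
      then have "(fst \<circ> \<beta>) ` \<sigma> \<subseteq> support (h (0, m w))" "(snd \<circ> \<beta>) ` \<sigma> \<subseteq> support (h (1, m w))"
        by (simp_all only: h(2,3)[rule_format])
      then show ?thesis using w(1) by blast
    qed
    \<comment> \<open>The chain consists of the first projection, \<open>track 0\<close> up to
      \<open>track (N - 1)\<close>, and the second projection. Neighbours are compared at the times
      \<open>0\<close>, \<open>i / N\<close> and \<open>1\<close>.\<close>
    define H where "H i = (if i = 0 then fst \<circ> \<beta> else if i \<le> N then track (i - 1) else snd \<circ> \<beta>)" for i
    have "c_contiguous (Suc N) J K (fst \<circ> \<beta>) (snd \<circ> \<beta>)"
    proof (rule c_contiguousI[OF Jo(1) K(1)])
      show "H 0 v = (fst \<circ> \<beta>) v" "H (Suc N) v = (snd \<circ> \<beta>) v" for v by (simp_all add: H_def)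
      fix i assume i: "i < Suc N"
      show "contiguous J K (H i) (H (Suc i))"
        unfolding contiguous_def
      proof
        fix \<sigma> assume \<sigma>: "\<sigma> \<in> simplices J"
        obtain w where w: "w \<in> \<sigma>" "(fst \<circ> \<beta>) ` \<sigma> \<subseteq> support (h (0, m w))" "(snd \<circ> \<beta>) ` \<sigma> \<subseteq> support (h (1, m w))"
          using top[OF \<sigma>] by blast
        have wJ: "w \<in> vertices J" using w(1) \<sigma> unfolding vertices_def by blast
        have ne: "f ` \<sigma> \<noteq> {}" for f :: "('a \<times> 'a) sd_vertex \<Rightarrow> 'a" using w(1) by blast
        consider "i = 0" | "0 < i" "i < N" | "i = N" using i by linarith
        then show "H i ` \<sigma> \<union> H (Suc i) ` \<sigma> \<in> simplices K"
        proof cases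
          case 1
          then have H: "H i = fst \<circ> \<beta>" "H (Suc i) = track 0" using N(1) by (simp_all add: H_def)
          show ?thesis
            unfolding H
            by (rule simplex[OF wJ _ w(2) track[OF \<sigma> w(1)] ne]) (use \<epsilon>(1) in auto)
        next
          case 2
          then have H: "H i = track (i - 1)" "H (Suc i) = track i" by (simp_all add: H_def)
          \<comment> \<open>At time \<open>i / N\<close> both maps can be tested:
            \<open>track i\<close> is centred there and \<open>track (i - 1)\<close> only
            \<open>1 / N < \<epsilon>\<close> away.\<close>
          have "real (i - 1) / real N - real i / real N = - (1 / real N)"
            using 2 by (simp add: diff_divide_distrib[symmetric] of_nat_diff)
          then have d: "\<bar>real (i - 1) / real N - real i / real N\<bar> < \<epsilon>" "\<bar>real i / real N - real i / real N\<bar> < \<epsilon>"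
            using N(2) \<epsilon>(1) by simp_all
          have t: "real i / real N \<in> {0..1}" using 2 by simp
          show ?thesis
            unfolding H
            by (rule simplex[OF wJ t track[OF \<sigma> w(1) _ t d(1)] track[OF \<sigma> w(1) _ t d(2)] ne]) (use 2 in auto)
        next
          case 3
          then have H: "H i = track (N - 1)" "H (Suc i) = snd \<circ> \<beta>" using N(1) by (simp_all add: H_def)
          have "real (N - 1) / real N - 1 = - (1 / real N)"
            using N(1) by (simp add: of_nat_diff field_simps)
          then have d: "\<bar>real (N - 1) / real N - 1\<bar> < \<epsilon>" using N(2) by simp
          show ?thesis
            unfolding H by (rule simplex[OF wJ _ track[OF \<sigma> w(1) _ _ d] w(3) ne]) auto
        qed
      qed
    qed simp
    then show "c_contiguous (Suc N) J K (fst \<circ> sd_to_base \<iota> (Suc b)) (snd \<circ> sd_to_base \<iota> (Suc b))"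
      by (simp only: \<beta>_def)
  qed
qed

text \<open>The open cover is shrunk to compact sets \<open>A i\<close>, and a fine subdivision is
  covered by the full subcomplexes on the vertices lying over them.\<close>

lemma contiguity_cover_from_motion_planners:
  fixes K :: "'a ocomplex"
  defines "X \<equiv> geometric_realization K"
  assumes K: "ordered_complex K" "finite_complex K"
    and \<iota>: "sd_approximations (K \<times>\<^sub>o K) \<iota>"
    and U: "\<forall>i\<le>k. openin (prod_topology X X) (U i)" "(\<Union>i\<le>k. U i) = topspace (prod_topology X X)"
      "\<forall>i\<le>k. has_motion_planner X (U i)"
  shows "\<exists>b c J. contiguity_cover (K \<times>\<^sub>o K) K \<iota> fst snd b c k J"
proof -
  let ?I = "top_of_set {0..1::real}" and ?XX = "prod_topology X X"
  let ?XXI = "prod_topology ?XX ?I"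
  let ?KK = "K \<times>\<^sub>o K"
  have KK: "ordered_complex ?KK" "finite_complex ?KK"
    using ordered_complex_prod[OF K(1) K(1)] finite_complex_prod[OF K K] by auto
  have XX: "topspace ?XX = realization_points K \<times> realization_points K" by (simp add: X_def)
  have cX0: "compact_space X"
    unfolding X_def by (rule compact_space_realization[OF K(2)])
  then have cX: "compact_space ?XX"
    by (simp add: compact_space_prod_topology)
  have cXI: "compact_space ?XXI"
    by (simp add: compact_space_prod_topology cX0 compact_space_subtopology)
  \<comment> \<open>The Lebesgue lemma carries a time coordinate, so the sets are multiplied by the
    interval; time 0 is inserted afterwards.\<close>
  have "\<exists>\<epsilon>>0. \<forall>x\<in>topspace ?XXI. \<exists>G\<in>(\<lambda>i. U i \<times> {0..1}) ` {..k}. \<forall>y\<in>topspace ?XXI.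
    near K \<epsilon> (fst x) (fst y) \<and> \<bar>snd x - snd y\<bar> < \<epsilon> \<longrightarrow> y \<in> G"
    unfolding X_def
  proof (rule lebesgue_number_realization[OF K])
    let ?Y = "prod_topology (prod_topology (geometric_realization K) (geometric_realization K)) ?I"
    show "compactin ?Y (topspace ?Y)"
      using cXI unfolding X_def compact_space_def .
    show "topspace ?Y \<subseteq> \<Union> ((\<lambda>i. U i \<times> {0..1}) ` {..k})"
      using U(2) unfolding X_def by auto
    show "openin ?Y G" if "G \<in> (\<lambda>i. U i \<times> {0..1}) ` {..k}" for G
      using that U(1) unfolding X_def by (auto simp: openin_prod_Times_iff)
  qed
  then obtain \<delta> where \<delta>: "\<delta> > 0" and leb: "\<forall>x\<in>topspace ?XXI. \<exists>G\<in>(\<lambda>i. U i \<times> {0..1}) ` {..k}. \<forall>y\<in>topspace ?XXI.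
    near K \<delta> (fst x) (fst y) \<and> \<bar>snd x - snd y\<bar> < \<delta> \<longrightarrow> y \<in> G"
    by blast
  have lebXX: "\<exists>i\<le>k. \<forall>z'\<in>topspace ?XX. near K \<delta> z z' \<longrightarrow> z' \<in> U i" if z: "z \<in> topspace ?XX" for z
  proof -
    have "(z, 0) \<in> topspace ?XXI" using z by simp
    then obtain i where i: "i \<le> k" "\<forall>y\<in>topspace ?XXI. near K \<delta> z (fst y) \<and> \<bar>0 - snd y\<bar> < \<delta> \<longrightarrow> y \<in> U i \<times> {0..1}"
      using leb by fastforce
    have "z' \<in> U i" if "z' \<in> topspace ?XX" "near K \<delta> z z'" for z'
      using bspec[OF i(2), of "(z', 0)"] that \<delta> by simp
    then show ?thesis using i(1) by blast
  qed
  \<comment> \<open>Its complement is a union of open balls around points outside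
    \<open>U i\<close>. The radius \<open>\<delta> / 2\<close> leaves the other half of
    \<open>\<delta>\<close> for the diameter of a simplex.\<close>
  define A where "A i = {z \<in> topspace ?XX. \<forall>z'\<in>topspace ?XX. near K (\<delta> / 2) z z' \<longrightarrow> z' \<in> U i}" for i
  have AU: "A i \<subseteq> U i" for i
    using near_refl[of "\<delta> / 2" K] \<delta> by (auto simp: A_def)
  have A: "compactin ?XX (A i)" for i
  proof (rule closedin_compact_space[OF cX])
    have nearopen: "openin ?XX {z \<in> topspace ?XX. near K (\<delta> / 2) z z'}" for z'
    proof -
      have "continuous_map ?XX euclideanreal (\<lambda>z. coord_dist K (fst z') (fst z))"
        "continuous_map ?XX euclideanreal (\<lambda>z. coord_dist K (snd z') (snd z))"
        using continuous_map_compose[OF continuous_map_fst continuous_coord_dist[OF K]]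
          continuous_map_compose[OF continuous_map_snd continuous_coord_dist[OF K]]
        by (simp_all add: o_def X_def)
      from this[THEN openin_continuous_map_preimage, of "{..<\<delta> / 2}"]
      have "openin ?XX ({z \<in> topspace ?XX. coord_dist K (fst z') (fst z) \<in> {..<\<delta> / 2}} \<inter>
        {z \<in> topspace ?XX. coord_dist K (snd z') (snd z) \<in> {..<\<delta> / 2}})" by (intro openin_Int) auto
      also have "{z \<in> topspace ?XX. coord_dist K (fst z') (fst z) \<in> {..<\<delta> / 2}} \<inter>
          {z \<in> topspace ?XX. coord_dist K (snd z') (snd z) \<in> {..<\<delta> / 2}} =
        {z \<in> topspace ?XX. near K (\<delta> / 2) z z'}"
        by (auto simp: near_def coord_dist_commute[of K "fst z'"] coord_dist_commute[of K "snd z'"])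
      finally show ?thesis .
    qed
    have "topspace ?XX - A i = (\<Union>z'\<in>topspace ?XX - U i. {z \<in> topspace ?XX. near K (\<delta> / 2) z z'})"
      unfolding A_def by blast
    then have "openin ?XX (topspace ?XX - A i)" using nearopen by auto
    then show "closedin ?XX (A i)" unfolding closedin_def by (auto simp: A_def)
  qed
  define good where "good i \<epsilon> c \<longleftrightarrow> (\<forall>b J. subcomplex J (Sd (Suc b) ?KK) \<and>
    (\<forall>v\<in>vertices J. marginals K (sd_point (Suc b) v) \<in> A i) \<and>
    (\<forall>\<sigma>\<in>simplices J. \<forall>v\<in>\<sigma>. \<forall>w\<in>\<sigma>.
      near K \<epsilon> (marginals K (sd_point (Suc b) v)) (marginals K (sd_point (Suc b) w))) \<longrightarrow>
    c_contiguous c J K (fst \<circ> sd_to_base \<iota> (Suc b)) (snd \<circ> sd_to_base \<iota> (Suc b)))" for i \<epsilon> c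
  have "\<exists>\<epsilon>>0. \<exists>c. good i \<epsilon> c" if "i \<le> k" for i
  proof -
    have "openin ?XX (U i)" "has_motion_planner X (U i)" using U(1,3) that by auto
    from contiguity_from_motion_planner[OF K \<iota> this[unfolded X_def] A[unfolded X_def] AU]
    show ?thesis unfolding good_def .
  qed
  then obtain \<epsilon> c where \<epsilon>: "\<And>i. i \<le> k \<Longrightarrow> \<epsilon> i > 0" and good: "\<And>i. i \<le> k \<Longrightarrow> good i (\<epsilon> i) (c i)"
    by metis
  \<comment> \<open>The bound \<open>\<delta> / 2\<close> serves the covering property, the
    \<open>\<epsilon> i\<close> serve contiguity.\<close>
  define \<eta> where "\<eta> = Min (insert (\<delta> / 2) (\<epsilon> ` {..k}))"
  have \<eta>: "\<eta> > 0" "\<eta> \<le> \<delta> / 2"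
    using \<delta> \<epsilon> by (auto simp: \<eta>_def)
  have \<eta>\<epsilon>: "\<eta> \<le> \<epsilon> i" if "i \<le> k" for i
    unfolding \<eta>_def using that by (intro Min_le) auto
  \<comment> \<open>The successor keeps \<open>N\<close> positive for the empty complex too, so that
    \<open>\<rho> < 1\<close>.\<close>
  define N where "N = Suc (card (vertices ?KK))"
  have V: "finite (vertices ?KK)" by (rule finite_vertices[OF KK(2,1)])
  have card_N: "card \<sigma> \<le> N" if "\<sigma> \<in> simplices ?KK" for \<sigma>
    using card_mono[OF V simplex_subset_vertices[OF that]] by (simp add: N_def)
  define \<rho> where "\<rho> = 1 - 1 / real N"
  have \<rho>: "0 \<le> \<rho>" "\<rho> < 1" by (auto simp: \<rho>_def N_def field_simps)
  \<comment> \<open>The Lipschitz factor from coordinate differences to the distance of marginals,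
    plus 1 so that it can be divided by.\<close>
  define D where "D = real (card (vertices K)) * real (card (vertices ?KK)) + 1"
  have D: "D > 0" by (simp add: D_def add_nonneg_pos)
  obtain b where b: "\<rho> ^ b < \<eta> / D" using real_arch_pow_inv[of "\<eta> / D" \<rho>] \<eta>(1) D \<rho>(2) by auto
  define m where "m v = marginals K (sd_point (Suc b) v)" for v
  have small: "near K \<eta> (m v) (m w)" if \<sigma>: "\<sigma> \<in> simplices (Sd (Suc b) ?KK)" "v \<in> \<sigma>" "w \<in> \<sigma>" for \<sigma> v w
    unfolding m_def
  proof (rule near_marginals[OF V])
    show "\<bar>sd_point (Suc b) v a - sd_point (Suc b) w a\<bar> \<le> \<rho> ^ Suc b" for a
      unfolding \<rho>_def by (rule sd_mesh[OF KK(1) card_N \<sigma>])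
    have "\<rho> ^ Suc b \<le> \<rho> ^ b" using \<rho> by (simp add: mult_left_le_one_le)
    then have "(D - 1) * \<rho> ^ Suc b \<le> D * \<rho> ^ b" using \<rho> D by (intro mult_mono) (auto simp: D_def)
    also have "\<dots> < \<eta>" using b D by (simp add: field_simps)
    finally show "real (card (vertices K)) * (real (card (vertices ?KK)) * \<rho> ^ Suc b) < \<eta>"
      by (simp add: D_def mult.assoc)
  qed
  have mXX: "m v \<in> topspace ?XX" if "v \<in> vertices (Sd (Suc b) ?KK)" for v
    unfolding m_def XX by (intro marginals(1) K sd_point_realization_points KK that)
  define J where "J i = full_subcomplex (Sd (Suc b) ?KK) {v. m v \<in> A i}" for i
  define c' where "c' = Max (c ` {..k})"
  have sub: "subcomplex (J i) (Sd (Suc b) ?KK)" for i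
    unfolding J_def by (intro subcomplex_full_subcomplex ordered_complex_Sd KK)
  have Jsimp: "simplices (J i) = {\<sigma> \<in> simplices (Sd (Suc b) ?KK). \<forall>v\<in>\<sigma>. m v \<in> A i}" for i
    by (auto simp: J_def full_subcomplex_def)
  have "\<exists>i\<le>k. \<sigma> \<in> simplices (J i)" if \<sigma>: "\<sigma> \<in> simplices (Sd (Suc b) ?KK)" for \<sigma>
  proof -
    obtain w where w: "w \<in> \<sigma>"
      using ordered_complex_nonempty[OF ordered_complex_Sd[OF KK(1)] \<sigma>] by blast
    have vert: "v \<in> vertices (Sd (Suc b) ?KK)" if "v \<in> \<sigma>" for v
      using simplex_subset_vertices[OF \<sigma>] that by (rule subsetD)
    obtain i where i: "i \<le> k" "\<And>z'. z' \<in> topspace ?XX \<Longrightarrow> near K \<delta> (m w) z' \<Longrightarrow> z' \<in> U i"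
      using lebXX[OF mXX[OF vert[OF w]]] by blast
    \<comment> \<open>The \<open>\<delta>\<close>-neighbourhood of \<open>m w\<close> lies in
      \<open>U i\<close>, and it contains the \<open>\<delta> / 2\<close>-neighbourhood of
      \<open>m v\<close>, as the two points are closer than \<open>\<delta> / 2\<close>.\<close>
    have "m v \<in> A i" if v: "v \<in> \<sigma>" for v
    proof -
      have "z' \<in> U i" if "z' \<in> topspace ?XX" "near K (\<delta> / 2) (m v) z'" for z'
        using near_triangle[OF near_mono[OF small[OF \<sigma> w v] \<eta>(2)] that(2)] that(1) by (intro i(2)) simp_all
      then show ?thesis using mXX[OF vert[OF v]] unfolding A_def by blast
    qed
    then show ?thesis using i(1) \<sigma> unfolding Jsimp by blast
  qed
  then have "covers J {..k} (Sd (Suc b) ?KK)"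
    unfolding covers_def using Jsimp by blast
  moreover have "c_contiguous c' (J i) K (fst \<circ> sd_to_base \<iota> (Suc b)) (snd \<circ> sd_to_base \<iota> (Suc b))"
    if i: "i \<le> k" for i
  proof (rule c_contiguous_mono)
    show "c i \<le> c'" using i by (simp add: c'_def)
    have vJ: "\<forall>v\<in>vertices (J i). marginals K (sd_point (Suc b) v) \<in> A i"
      using Jsimp unfolding vertices_def m_def by blast
    have nJ: "\<forall>\<sigma>\<in>simplices (J i). \<forall>v\<in>\<sigma>. \<forall>w\<in>\<sigma>.
        near K (\<epsilon> i) (marginals K (sd_point (Suc b) v)) (marginals K (sd_point (Suc b) w))"
    proof (intro ballI)
      fix \<sigma> v w assume "\<sigma> \<in> simplices (J i)" "v \<in> \<sigma>" "w \<in> \<sigma>"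
      then have "near K \<eta> (m v) (m w)" using Jsimp small by blast
      then show "near K (\<epsilon> i) (marginals K (sd_point (Suc b) v)) (marginals K (sd_point (Suc b) w))"
        using near_mono \<eta>\<epsilon>[OF i] unfolding m_def by blast
    qed
    show "c_contiguous (c i) (J i) K (fst \<circ> sd_to_base \<iota> (Suc b)) (snd \<circ> sd_to_base \<iota> (Suc b))"
      using good[OF i] sub[of i] vJ nJ unfolding good_def by blast
  qed
  ultimately have "contiguity_cover ?KK K \<iota> fst snd (Suc b) c' k J"
    unfolding contiguity_cover_def using sub by blast
  then show ?thesis by blast
qed

theorem proposition3p1:
  fixes K :: "'a ocomplex"
    and \<iota> :: "nat \<Rightarrow> ('a \<times> 'a) sd_vertex \<Rightarrow> ('a \<times> 'a) sd_vertex"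
  assumes "ordered_complex K"
    and "finite_complex K"
    and "sd_approximations (K \<times>\<^sub>o K) \<iota>"
  shows "TC (geometric_realization K) = SimpD (K \<times>\<^sub>o K) K \<iota> fst snd \<and>
         SimpD (K \<times>\<^sub>o K) K \<iota> fst snd = SC K \<iota>"
proof
  let ?X = "geometric_realization K"
  \<comment> \<open>Both invariants are least values of \<open>k\<close>, so it suffices that the
    conditions agree for each \<open>k\<close> separately.\<close>
  have "(\<exists>U. (\<forall>i\<le>k. openin (prod_topology ?X ?X) (U i)) \<and>
      (\<Union>i\<le>k. U i) = topspace (prod_topology ?X ?X) \<and> (\<forall>i\<le>k. has_motion_planner ?X (U i))) \<longleftrightarrow>
    (\<exists>b c J. contiguity_cover (K \<times>\<^sub>o K) K \<iota> fst snd b c k J)" for k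
  proof
    assume "\<exists>U. (\<forall>i\<le>k. openin (prod_topology ?X ?X) (U i)) \<and>
      (\<Union>i\<le>k. U i) = topspace (prod_topology ?X ?X) \<and> (\<forall>i\<le>k. has_motion_planner ?X (U i))"
    then show "\<exists>b c J. contiguity_cover (K \<times>\<^sub>o K) K \<iota> fst snd b c k J"
      by (elim exE conjE) (rule contiguity_cover_from_motion_planners[OF assms])
  next
    assume "\<exists>b c J. contiguity_cover (K \<times>\<^sub>o K) K \<iota> fst snd b c k J"
    then show "\<exists>U. (\<forall>i\<le>k. openin (prod_topology ?X ?X) (U i)) \<and>
      (\<Union>i\<le>k. U i) = topspace (prod_topology ?X ?X) \<and> (\<forall>i\<le>k. has_motion_planner ?X (U i))"
      by (elim exE) (rule motion_planners_from_contiguity[OF assms])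
  qed
  then show "TC ?X = SimpD (K \<times>\<^sub>o K) K \<iota> fst snd"
    unfolding TC_def SimpD_eq_least[OF assms(3)] by presburger
  show "SimpD (K \<times>\<^sub>o K) K \<iota> fst snd = SC K \<iota>"
    by (simp only: SimpD_def SimpD_b_def SimpD_bc_def SC_def SC_b_def SC_bc_def)
qed

end
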